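(* Let $A$ be a unital C*-algebra, let $\{x_j\}_{j\in\mathbb J}$ and $\{y_j\}_{j\in\mathbb J}$ be standard frames of finitely or countably generated Hilbert $A$-modules $\mathcal H$ and $\mathcal K$, respectively, where $\mathcal H\oplus\mathcal K$ possesses a Riesz basis, and let $S_x$ and $S_y$ be their frame operators. The following conditions are equivalent: (i) The frames $\{x_j\}_j$ and $\{y_j\}_j$ are strongly disjoint. (ii) The canonical dual frames $\{S_x(x_j)\}_j$ and $\{S_y(y_j)\}_j$ are strongly disjoint. (iii) $\{x_j\oplus y_j\}_j$ is a standard frame of $\mathcal H\oplus\mathcal K$ whose frame operator $S_{x+y}$ equals the sum $S_x\oplus S_y$ of the frame operators $S_x$ and $S_y$, i.e. the canonical dual frame of $\{x_j\oplus y_j\}_j$ is the inner sum of the canonical dual frames of $\{x_j\}_j$ and $\{y_j\}_j$. (iv) $\sum_j\langle x,S_x(x_j)\rangle y_j=0$ for any $x\in\mathcal H$. (v) $\sum_j\langle y,S_y(y_j)\rangle x_j=0$ for any $y\in\mathcal K$. (vi) $\sum_j\langle x,x_j\rangle S_y(y_j)=0$ for any $x\in\mathcal H$. (vii) $\sum_j\langle y,y_j\rangle S_x(x_j)=0$ for any $y\in\mathcal K$. (viii) $\sum_j\langle x,x_j\rangle y_j=0$ for any $x\in\mathcal H$. (ix) $\sum_j\langle y,y_j\rangle x_j=0$ for any $y\in\mathcal K$.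
   Context: Hilbert $A$-modules are left modules whose $A$-valued inner product is $A$-linear in the first argument; the direct sum carries $\langle x\oplus y,x'\oplus y'\rangle=\langle x,x'\rangle+\langle y,y'\rangle$. A Hilbert $A$-module is finitely generated if it is the $A$-linear span of a finite subset; it is countably generated if the finite $A$-linear combinations of some countable subset are norm-dense. $l_2(A)=\{\{a_i\}_{i\in\mathbb N}: a_i\in A,\ \sum_i a_ia_i^*\text{ converges in norm}\}$ with $\langle a,b\rangle=\sum_i a_ib_i^*$ and standard orthonormal basis $\{e_i\}_i$. Let $\mathbb J$ be a finite or countable index set, identified with a subset of $\mathbb N$. A sequence $\{x_j\}_{j\in\mathbb J}$ in a Hilbert $A$-module $\mathcal H$ is a frame if there are real constants $C,D>0$ with $C\langle x,x\rangle\le\sum_j\langle x,x_j\rangle\langle x_j,x\rangle\le D\langle x,x\rangle$ for every $x\in\mathcal H$. It is standard if the middle sum converges in norm for every $x$, and normalized tight if one can take $C=D=1$. The frame transform of a standard frame is $\theta:\mathcal H\to l_2(A)$, $\theta(x)=\{\langle x,x_j\rangle\}_j$; it is adjointable with $\theta^*(e_j)=x_j$. The frame operator is $S=(\theta^*\theta)^{-1}$ (positive and invertible on $\mathcal H$), and $\{S(x_j)\}_j$ is again a standard frame, the canonical dual frame of $\{x_j\}_j$. A standard Riesz basis is a standard frame $\{x_j\}_j$ that is a generating set such that $A$-linear combinations $\sum_{j\in S}a_jx_j$ with $a_j\in A$, $S\subseteq\mathbb J$, vanish if and only if every summand $a_jx_j$, $j\in S$, vanishes. The inner sum of $\{x_j\}_j$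 and $\{y_j\}_j$ is the sequence $\{x_j\oplus y_j\}_j$ in $\mathcal H\oplus\mathcal K$. Two standard normalized tight frames of $\mathcal H$ and $\mathcal K$ are strongly disjoint if their inner sum is a standard normalized tight frame of $\mathcal H\oplus\mathcal K$. Two standard frames $\{x_j\}_j$, $\{y_j\}_j$ of $\mathcal H$, $\mathcal K$ are strongly disjoint if there are invertible adjointable bounded operators $T_1$ on $\mathcal H$ and $T_2$ on $\mathcal K$ such that $\{T_1(x_j)\}_j$ and $\{T_2(y_j)\}_j$ are strongly disjoint standard normalized tight frames of $\mathcal H$ and $\mathcal K$. *)

theory Defs
  imports "HOL-Analysis.Analysis"
begin

section \<open>Unital C*-algebras\<close>

text \<open>
  The superclass \<^class>\<open>real_normed_algebra_1\<close> demands \<open>norm 1 = 1\<close>, which every nonzero unital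
  C*-algebra satisfies; so only the zero algebra is left out.
\<close>

class cstar_algebra = real_normed_algebra_1 + banach +
  fixes scaleC :: "complex \<Rightarrow> 'a \<Rightarrow> 'a"
    and star :: "'a \<Rightarrow> 'a"
  assumes scaleC_add_right: "scaleC c (a + b) = scaleC c a + scaleC c b"
    and scaleC_add_left: "scaleC (c + d) a = scaleC c a + scaleC d a"
    and scaleC_scaleC: "scaleC c (scaleC d a) = scaleC (c * d) a"
    and scaleC_of_real: "scaleC (complex_of_real r) a = scaleR r a"
    and mult_scaleC_left: "scaleC c a * b = scaleC c (a * b)"
    and mult_scaleC_right: "a * scaleC c b = scaleC c (a * b)"
    and norm_scaleC: "norm (scaleC c a) = cmod c * norm a"
    and star_add: "star (a + b) = star a + star b"
    and star_scaleC: "star (scaleC c a) = scaleC (cnj c) (star a)"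
    and star_mult: "star (a * b) = star b * star a"
    and star_star: "star (star a) = a"
    and cstar_identity: "norm (star a * a) = (norm a)\<^sup>2"

definition cspectrum :: "'a::cstar_algebra \<Rightarrow> complex set" where
  "cspectrum a = {c. \<not> (\<exists>b. b * (a - scaleC c 1) = 1 \<and> (a - scaleC c 1) * b = 1)}"

definition cstar_positive :: "'a::cstar_algebra \<Rightarrow> bool" where
  "cstar_positive a \<longleftrightarrow> star a = a \<and> cspectrum a \<subseteq> complex_of_real ` {0..}"

definition cstar_le :: "'a::cstar_algebra \<Rightarrow> 'a \<Rightarrow> bool" where
  "cstar_le a b \<longleftrightarrow> cstar_positive (b - a)"


section \<open>Hilbert modules\<close>

text \<open>
  The norm of a Hilbert module is always the one given by its inner product. In particular the
  direct sum lives on the product type, but does not use the norm (or topology) of the product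
  type class.
\<close>

definition mod_norm :: "('h \<Rightarrow> 'h \<Rightarrow> 'a::cstar_algebra) \<Rightarrow> 'h \<Rightarrow> real" where
  "mod_norm ip x = sqrt (norm (ip x x))"

text \<open>
  The complex vector space structure of a Hilbert module over a unital algebra is
  \<open>c \<cdot> x = smul (scaleC c 1) x\<close>, so it is not a separate parameter.
\<close>

locale hilbert_module =
  fixes smul :: "'a::cstar_algebra \<Rightarrow> 'h::ab_group_add \<Rightarrow> 'h"
    and ip :: "'h \<Rightarrow> 'h \<Rightarrow> 'a"
  assumes smul_add_right: "smul a (x + y) = smul a x + smul a y"
    and smul_add_left: "smul (a + b) x = smul a x + smul b x"
    and smul_smul: "smul a (smul b x) = smul (a * b) x"
    and smul_one: "smul 1 x = x"
    and ip_add_left: "ip (x + y) z = ip x z + ip y z"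
    and ip_smul_left: "ip (smul a x) y = a * ip x y"
    and ip_star: "star (ip x y) = ip y x"
    and ip_positive: "cstar_positive (ip x x)"
    and ip_definite: "ip x x = 0 \<Longrightarrow> x = 0"
    and mod_complete:
      "\<lbrakk>\<And>e. e > 0 \<Longrightarrow> \<exists>N. \<forall>m\<ge>N. \<forall>n\<ge>N. mod_norm ip (X m - X n) < e\<rbrakk>
        \<Longrightarrow> \<exists>l. (\<lambda>n. mod_norm ip (X n - l)) \<longlonglongrightarrow> 0"

definition dsum_smul ::
  "('a \<Rightarrow> 'h \<Rightarrow> 'h) \<Rightarrow> ('a \<Rightarrow> 'k \<Rightarrow> 'k) \<Rightarrow> 'a::cstar_algebra \<Rightarrow> 'h \<times> 'k \<Rightarrow> 'h \<times> 'k" where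
  "dsum_smul smulH smulK a u = (smulH a (fst u), smulK a (snd u))"

definition dsum_ip ::
  "('h \<Rightarrow> 'h \<Rightarrow> 'a) \<Rightarrow> ('k \<Rightarrow> 'k \<Rightarrow> 'a) \<Rightarrow> 'h \<times> 'k \<Rightarrow> 'h \<times> 'k \<Rightarrow> 'a::cstar_algebra" where
  "dsum_ip ipH ipK u v = ipH (fst u) (fst v) + ipK (snd u) (snd v)"

definition mod_span :: "('a::cstar_algebra \<Rightarrow> 'h::ab_group_add \<Rightarrow> 'h) \<Rightarrow> 'h set \<Rightarrow> 'h set" where
  "mod_span smul G = {\<Sum>g\<in>F. smul (a g) g |a F. finite F \<and> F \<subseteq> G}"

definition mod_generating ::
  "('a::cstar_algebra \<Rightarrow> 'h::ab_group_add \<Rightarrow> 'h) \<Rightarrow> ('h \<Rightarrow> 'h \<Rightarrow> 'a) \<Rightarrow> 'h set \<Rightarrow> bool" where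
  "mod_generating smul ip G \<longleftrightarrow> (\<forall>x. \<forall>e>0. \<exists>y\<in>mod_span smul G. mod_norm ip (x - y) < e)"

definition finitely_generated :: "('a::cstar_algebra \<Rightarrow> 'h::ab_group_add \<Rightarrow> 'h) \<Rightarrow> bool" where
  "finitely_generated smul \<longleftrightarrow> (\<exists>G. finite G \<and> mod_span smul G = UNIV)"

definition countably_generated ::
  "('a::cstar_algebra \<Rightarrow> 'h::ab_group_add \<Rightarrow> 'h) \<Rightarrow> ('h \<Rightarrow> 'h \<Rightarrow> 'a) \<Rightarrow> bool" where
  "countably_generated smul ip \<longleftrightarrow> (\<exists>G. countable G \<and> mod_generating smul ip G)"

text \<open>Norm convergence to \<open>s\<close> of a series over \<open>J \<subseteq> \<nat>\<close>, summed in the order of \<open>\<nat>\<close>.\<close>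

definition mod_sums ::
  "('h \<Rightarrow> 'h \<Rightarrow> 'a::cstar_algebra) \<Rightarrow> nat set \<Rightarrow> (nat \<Rightarrow> 'h::ab_group_add) \<Rightarrow> 'h \<Rightarrow> bool" where
  "mod_sums ip J f s \<longleftrightarrow> (\<lambda>n. mod_norm ip ((\<Sum>j\<in>J \<inter> {..<n}. f j) - s)) \<longlonglongrightarrow> 0"

definition l2 :: "(nat \<Rightarrow> 'a::cstar_algebra) set" where
  "l2 = {a. summable (\<lambda>i. a i * star (a i))}"

definition l2_ip :: "(nat \<Rightarrow> 'a::cstar_algebra) \<Rightarrow> (nat \<Rightarrow> 'a) \<Rightarrow> 'a" where
  "l2_ip a b = (\<Sum>i. a i * star (b i))"

text \<open>Modules enter with a carrier here because \<^const>\<open>l2\<close> is a set and not a type.\<close>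

definition is_adjoint ::
  "'h set \<Rightarrow> ('h \<Rightarrow> 'h \<Rightarrow> 'a) \<Rightarrow> 'k set \<Rightarrow> ('k \<Rightarrow> 'k \<Rightarrow> 'a)
    \<Rightarrow> ('h \<Rightarrow> 'k) \<Rightarrow> ('k \<Rightarrow> 'h) \<Rightarrow> bool" where
  "is_adjoint H ipH K ipK T T' \<longleftrightarrow>
    T ` H \<subseteq> K \<and> T' ` K \<subseteq> H \<and> (\<forall>x\<in>H. \<forall>y\<in>K. ipK (T x) y = ipH x (T' y))"

definition bounded_adjointable ::
  "('a::cstar_algebra \<Rightarrow> 'h::ab_group_add \<Rightarrow> 'h) \<Rightarrow> ('h \<Rightarrow> 'h \<Rightarrow> 'a) \<Rightarrow> ('h \<Rightarrow> 'h) \<Rightarrow> bool" where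
  "bounded_adjointable smul ip T \<longleftrightarrow>
    (\<forall>x y. T (x + y) = T x + T y) \<and> (\<forall>a x. T (smul a x) = smul a (T x)) \<and>
    (\<exists>B. \<forall>x. mod_norm ip (T x) \<le> B * mod_norm ip x) \<and>
    (\<exists>T'. is_adjoint UNIV ip UNIV ip T T')"

definition invertible_adjointable ::
  "('a::cstar_algebra \<Rightarrow> 'h::ab_group_add \<Rightarrow> 'h) \<Rightarrow> ('h \<Rightarrow> 'h \<Rightarrow> 'a) \<Rightarrow> ('h \<Rightarrow> 'h) \<Rightarrow> bool" where
  "invertible_adjointable smul ip T \<longleftrightarrow>
    bounded_adjointable smul ip T \<and>
    (\<exists>R. bounded_adjointable smul ip R \<and> R \<circ> T = id \<and> T \<circ> R = id)"


section \<open>Frames\<close>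

text \<open>
  Norm convergence of the middle series is part of the predicate, so only standard frames are
  considered. Only the values \<open>f j\<close> with \<open>j \<in> J\<close> matter.
\<close>

definition standard_frame_bounds ::
  "('h \<Rightarrow> 'h \<Rightarrow> 'a::cstar_algebra) \<Rightarrow> nat set \<Rightarrow> (nat \<Rightarrow> 'h) \<Rightarrow> real \<Rightarrow> real \<Rightarrow> bool" where
  "standard_frame_bounds ip J f C D \<longleftrightarrow>
    (\<forall>x. summable (\<lambda>j. if j \<in> J then ip x (f j) * ip (f j) x else 0) \<and>
         cstar_le (C *\<^sub>R ip x x) (\<Sum>j. if j \<in> J then ip x (f j) * ip (f j) x else 0) \<and>
         cstar_le (\<Sum>j. if j \<in> J then ip x (f j) * ip (f j) x else 0) (D *\<^sub>R ip x x))"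

definition standard_frame ::
  "('h \<Rightarrow> 'h \<Rightarrow> 'a::cstar_algebra) \<Rightarrow> nat set \<Rightarrow> (nat \<Rightarrow> 'h) \<Rightarrow> bool" where
  "standard_frame ip J f \<longleftrightarrow> (\<exists>C>0. \<exists>D>0. standard_frame_bounds ip J f C D)"

definition standard_tight_frame ::
  "('h \<Rightarrow> 'h \<Rightarrow> 'a::cstar_algebra) \<Rightarrow> nat set \<Rightarrow> (nat \<Rightarrow> 'h) \<Rightarrow> bool" where
  "standard_tight_frame ip J f \<longleftrightarrow> standard_frame_bounds ip J f 1 1"

definition frame_transform ::
  "('h \<Rightarrow> 'h \<Rightarrow> 'a::cstar_algebra) \<Rightarrow> nat set \<Rightarrow> (nat \<Rightarrow> 'h) \<Rightarrow> 'h \<Rightarrow> nat \<Rightarrow> 'a" where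
  "frame_transform ip J f x = (\<lambda>j. if j \<in> J then ip x (f j) else 0)"

text \<open>For a standard frame the adjoint of the frame transform exists and is unique on \<^const>\<open>l2\<close>.\<close>

definition frame_transform_adj ::
  "('h \<Rightarrow> 'h \<Rightarrow> 'a::cstar_algebra) \<Rightarrow> nat set \<Rightarrow> (nat \<Rightarrow> 'h) \<Rightarrow> (nat \<Rightarrow> 'a) \<Rightarrow> 'h" where
  "frame_transform_adj ip J f =
    (SOME T'. is_adjoint UNIV ip l2 l2_ip (frame_transform ip J f) T')"

text \<open>Note the inverse: this is \<open>(\<theta>* \<theta>)\<inverse>\<close>, not \<open>\<theta>* \<theta>\<close>.\<close>

definition frame_operator ::
  "('h \<Rightarrow> 'h \<Rightarrow> 'a::cstar_algebra) \<Rightarrow> nat set \<Rightarrow> (nat \<Rightarrow> 'h) \<Rightarrow> 'h \<Rightarrow> 'h" where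
  "frame_operator ip J f = inv (frame_transform_adj ip J f \<circ> frame_transform ip J f)"

definition canonical_dual ::
  "('h \<Rightarrow> 'h \<Rightarrow> 'a::cstar_algebra) \<Rightarrow> nat set \<Rightarrow> (nat \<Rightarrow> 'h) \<Rightarrow> nat \<Rightarrow> 'h" where
  "canonical_dual ip J f j = frame_operator ip J f (f j)"

text \<open>
  The set \<open>S\<close> may be infinite; the combination then vanishes if the series converges in norm to 0.
\<close>

definition standard_riesz_basis ::
  "('a::cstar_algebra \<Rightarrow> 'h::ab_group_add \<Rightarrow> 'h) \<Rightarrow> ('h \<Rightarrow> 'h \<Rightarrow> 'a)
    \<Rightarrow> nat set \<Rightarrow> (nat \<Rightarrow> 'h) \<Rightarrow> bool" where
  "standard_riesz_basis smul ip J f \<longleftrightarrow>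
    standard_frame ip J f \<and> mod_generating smul ip (f ` J) \<and>
    (\<forall>S\<subseteq>J. \<forall>a. mod_sums ip S (\<lambda>j. smul (a j) (f j)) 0 \<longleftrightarrow> (\<forall>j\<in>S. smul (a j) (f j) = 0))"

definition inner_sum :: "(nat \<Rightarrow> 'h) \<Rightarrow> (nat \<Rightarrow> 'k) \<Rightarrow> nat \<Rightarrow> 'h \<times> 'k" where
  "inner_sum f g j = (f j, g j)"

definition strongly_disjoint_tight ::
  "('h \<Rightarrow> 'h \<Rightarrow> 'a::cstar_algebra) \<Rightarrow> ('k \<Rightarrow> 'k \<Rightarrow> 'a)
    \<Rightarrow> nat set \<Rightarrow> (nat \<Rightarrow> 'h) \<Rightarrow> (nat \<Rightarrow> 'k) \<Rightarrow> bool" where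
  "strongly_disjoint_tight ipH ipK J f g \<longleftrightarrow>
    standard_tight_frame ipH J f \<and> standard_tight_frame ipK J g \<and>
    standard_tight_frame (dsum_ip ipH ipK) J (inner_sum f g)"

definition strongly_disjoint ::
  "('a::cstar_algebra \<Rightarrow> 'h::ab_group_add \<Rightarrow> 'h) \<Rightarrow> ('h \<Rightarrow> 'h \<Rightarrow> 'a)
    \<Rightarrow> ('a \<Rightarrow> 'k::ab_group_add \<Rightarrow> 'k) \<Rightarrow> ('k \<Rightarrow> 'k \<Rightarrow> 'a)
    \<Rightarrow> nat set \<Rightarrow> (nat \<Rightarrow> 'h) \<Rightarrow> (nat \<Rightarrow> 'k) \<Rightarrow> bool" where
  "strongly_disjoint smulH ipH smulK ipK J f g \<longleftrightarrow>
    standard_frame ipH J f \<and> standard_frame ipK J g \<and>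
    (\<exists>T\<^sub>1 T\<^sub>2. invertible_adjointable smulH ipH T\<^sub>1 \<and> invertible_adjointable smulK ipK T\<^sub>2 \<and>
      strongly_disjoint_tight ipH ipK J (\<lambda>j. T\<^sub>1 (f j)) (\<lambda>j. T\<^sub>2 (g j)))"

end

theory Submission
  imports Defs
begin

text \<open>
  For frames \<open>f\<close> of \<open>\<H>\<close> and \<open>g\<close> of \<open>\<K>\<close> put \<open>B\<^sub>f\<^sub>,\<^sub>g(u, w) = \<Sum>\<^sub>j \<langle>u, f\<^sub>j\<rangle>\<langle>g\<^sub>j, w\<rangle>\<close>. Each of the nine
  conditions says that \<open>B\<^sub>x\<^sub>,\<^sub>y = 0\<close>: replacing \<open>f\<close> by \<open>T f\<close> for an adjointable \<open>T\<close> turns \<open>B(u, w)\<close> into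
  \<open>B(T\<^sup>* u, w)\<close>, and the frame operators as well as the adjoints of invertible operators are onto. If
  \<open>B\<^sub>x\<^sub>,\<^sub>y = 0\<close>, then \<open>T\<^sub>1 = S\<^sub>x\<^sup>1\<^sup>/\<^sup>2\<close> and \<open>T\<^sub>2 = S\<^sub>y\<^sup>1\<^sup>/\<^sup>2\<close> witness strong disjointness; conversely tightness of
  the inner sum makes \<open>B + B\<^sup>*\<close> vanish, and replacing \<open>w\<close> by \<open>i w\<close> separates the two terms.

  Positivity in the algebra is handled through the norm: a self-adjoint \<open>a\<close> is positive iff
  \<open>\<parallel>t - a\<parallel> \<le> t\<close> for some real \<open>t\<close>. Square roots, in the algebra and on the module, are fixed points of
  the contraction \<open>y \<mapsto> (b + y\<^sup>2) / 2\<close>, which give \<open>(1 - y)\<^sup>2 = 1 - b\<close> for \<open>\<parallel>b\<parallel> < 1\<close>.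
\<close>

section \<open>Positive elements of a C*-algebra\<close>

text \<open>The order is defined through the spectrum, so closure of the positive elements under
  sums and limits, and positivity of \<open>star x * x\<close>, are theorems here, and they are
  reached without functional calculus. The norm description settles sums and limits; the way back to
  the spectrum rests on the norm of a self-adjoint element being, up to sign, a spectral value
  (\<open>norm_attained\<close>). Roots in the algebra commute with all that commutes with the given
  element, which makes products of commuting positive elements accessible. Condition (iii) concerns
  blocks: for the inner sum, the composite of the frame transform and its adjoint is a 2 by 2
  operator matrix whose diagonal entries belong to the two frames and whose off-diagonal entries are
  given by \<open>B\<close> and its adjoint. It is diagonal exactly if its inverse is. To take the
  root of a frame operator, the composite is written as \<open>E (1 - R)\<close>; the lower frame
  bound keeps the form of \<open>R\<close> strictly below that of the identity, and a Cauchy-Schwarz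
  argument turns this into a norm bound.\<close>

lemma star_0 [simp]: "star (0::'a::cstar_algebra) = 0"
  using star_add[of "0::'a" 0] by simp

lemma star_1 [simp]: "star (1::'a::cstar_algebra) = 1"
  by (metis mult_1_left mult_1_right star_mult star_star)

lemma star_scaleR [simp]: "star (r *\<^sub>R (a::'a::cstar_algebra)) = r *\<^sub>R star a"
  by (metis scaleC_of_real star_scaleC complex_cnj_complex_of_real)

lemma star_of_real [simp]: "star (of_real r :: 'a::cstar_algebra) = of_real r"
  by (simp add: of_real_def)

lemma star_minus [simp]: "star (- (a::'a::cstar_algebra)) = - star a"
  using star_scaleR[of "-1" a] by simp

lemma star_diff: "star ((a::'a::cstar_algebra) - b) = star a - star b"
  by (metis diff_conv_add_uminus star_add star_minus)

lemma star_power: "star ((a::'a::cstar_algebra) ^ n) = star a ^ n"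
  by (induction n) (simp_all add: star_mult power_commutes)

lemma norm_star [simp]: "norm (star (a::'a::cstar_algebra)) = norm a"
proof -
  have "norm b \<le> norm (star b)" for b :: 'a
  proof (cases "b = 0")
    case False
    have "norm b * norm b \<le> norm (star b) * norm b"
      using cstar_identity[of b] norm_mult_ineq[of "star b" b] by (simp add: power2_eq_square)
    then show ?thesis
      using False by simp
  qed simp
  from this[of a] this[of "star a"] show ?thesis
    by (simp add: star_star)
qed

lemma bounded_linear_star: "bounded_linear (star :: 'a::cstar_algebra \<Rightarrow> 'a)"
  by (rule bounded_linear_intro[where K = 1]) (simp_all add: star_add)

lemma norm_selfadjoint_square:
  "star (a::'a::cstar_algebra) = a \<Longrightarrow> norm (a * a) = norm a ^ 2"
  using cstar_identity[of a] by simp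

text \<open>The C*-identity gives exponents that are powers of two. A general \<open>n\<close> lies
  below \<open>2 ^ n\<close>, and submultiplicativity lets the surplus factor
  \<open>norm a ^ (2 ^ n - n)\<close> be cancelled.\<close>

lemma norm_selfadjoint_power:
  fixes a :: "'a::cstar_algebra"
  assumes a: "star a = a"
  shows "norm (a ^ n) = norm a ^ n"
proof (cases "a = 0")
  case False
  have two: "norm (a ^ (2 ^ k)) = norm a ^ (2 ^ k)" for k
  proof (induction k)
    case (Suc k)
    have "star (a ^ (2 ^ k)) = a ^ (2 ^ k)"
      using a by (simp add: star_power)
    then have "norm (a ^ (2 ^ k) * a ^ (2 ^ k)) = norm (a ^ (2 ^ k)) ^ 2"
      by (rule norm_selfadjoint_square)
    then show ?case
      using Suc by (simp add: mult_2 power_add power2_eq_square)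
  qed simp
  have n: "n \<le> 2 ^ n"
    by (simp add: less_imp_le)
  have "norm a ^ n * norm a ^ (2 ^ n - n) = norm (a ^ (2 ^ n))"
    using n two[of n] by (simp flip: power_add)
  also have "\<dots> = norm (a ^ n * a ^ (2 ^ n - n))"
    using n by (simp flip: power_add)
  also have "\<dots> \<le> norm (a ^ n) * norm (a ^ (2 ^ n - n))"
    by (rule norm_mult_ineq)
  also have "\<dots> \<le> norm (a ^ n) * norm a ^ (2 ^ n - n)"
    by (intro mult_left_mono norm_power_ineq) simp
  finally have "norm a ^ n \<le> norm (a ^ n)"
    using False by simp
  then show ?thesis
    using norm_power_ineq[of a n] by simp
qed (cases n, simp_all)

lemma sqrt_one_minus_selfadjoint:
  fixes b :: "'a::cstar_algebra"
  assumes b: "star b = b" "norm b < 1"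
  obtains s where "star s = s" "s * s = 1 - b" "\<And>c. c * b = b * c \<Longrightarrow> c * s = s * c"
proof -
  \<comment> \<open>The smaller root of \<open>t = (norm b + t * t) / 2\<close>: the ball of this
    radius is mapped into itself, and on it the map has Lipschitz constant \<rho>, which is below 1
    because \<open>norm b < 1\<close>.\<close>
  define \<rho> where "\<rho> = 1 - sqrt (1 - norm b)"
  have \<rho>: "0 \<le> \<rho>" "\<rho> < 1" "(norm b + \<rho> * \<rho>) / 2 = \<rho>"
    using b by (auto simp: \<rho>_def field_simps)
  \<comment> \<open>Self-adjointness and commutation with the commutant of \<open>b\<close> are
    closed conditions preserved by the map, so putting them into the domain transfers them to the
    fixed point.\<close>
  define Y where "Y = {y. star y = y} \<inter> {y. norm y \<le> \<rho>} \<inter> {y. \<forall>c. c * b = b * c \<longrightarrow> c * y = y * c}"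
  define f where "f y = (1 / 2) *\<^sub>R (b + y * y)" for y
  have "closed Y"
    unfolding Y_def Collect_all_eq Collect_imp_eq
    by (intro closed_Int closed_INT ballI closed_Un closed_Collect_eq closed_Collect_le
        continuous_intros bounded_linear.continuous_on[OF bounded_linear_star])
      (simp_all add: Collect_const flip: Collect_neg_eq)
  then have "complete Y"
    by (simp add: complete_eq_closed)
  moreover have "0 \<in> Y"
    using \<rho> by (simp add: Y_def)
  moreover have "f ` Y \<subseteq> Y"
  proof (clarify)
    fix y assume "y \<in> Y"
    then have y: "star y = y" "norm y \<le> \<rho>" and comm: "c * b = b * c \<Longrightarrow> c * y = y * c" for c
      unfolding Y_def by blast+
    have "norm (f y) \<le> (norm b + norm y * norm y) / 2"
      using norm_triangle_ineq[of b "y * y"] norm_mult_ineq[of y y] by (simp add: f_def)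
    also have "\<dots> \<le> (norm b + \<rho> * \<rho>) / 2"
      using y \<rho> mult_mono[of "norm y" \<rho> "norm y" \<rho>] by simp
    finally have "norm (f y) \<le> \<rho>"
      using \<rho> by simp
    moreover have "c * f y = f y * c" if "c * b = b * c" for c
    proof -
      have "c * y = y * c"
        by (rule comm[OF that])
      then have "c * (y * y) = y * y * c"
        by (metis mult.assoc)
      then have "c * (b + y * y) = (b + y * y) * c"
        using that by (simp only: distrib_left distrib_right)
      then show ?thesis
        by (simp add: f_def)
    qed
    moreover have "star (f y) = f y"
      using y b(1) by (simp add: f_def star_add star_mult)
    ultimately show "f y \<in> Y"
      unfolding Y_def by blast
  qed
  moreover have "dist (f y) (f z) \<le> \<rho> * dist y z" if "y \<in> Y" "z \<in> Y" for y z
  proof -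
    have "f y - f z = (1/2) *\<^sub>R ((y - z) * y + z * (y - z))"
      by (simp add: f_def algebra_simps)
    then have "norm (f y - f z) \<le> (norm (y - z) * norm y + norm z * norm (y - z)) / 2"
      using norm_triangle_ineq[of "(y - z) * y" "z * (y - z)"]
        norm_mult_ineq[of "y - z" y] norm_mult_ineq[of z "y - z"] by simp
    also have "\<dots> \<le> (norm (y - z) * \<rho> + \<rho> * norm (y - z)) / 2"
    proof -
      have "norm y \<le> \<rho>" "norm z \<le> \<rho>"
        using that unfolding Y_def by blast+
      then show ?thesis
        using \<rho>(1) by (intro divide_right_mono add_mono mult_mono) auto
    qed
    finally show ?thesis
      by (simp add: dist_norm)
  qed
  ultimately obtain y where y: "y \<in> Y" "f y = y"
    using Banach_fix[of Y \<rho> f] \<rho> by blast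
  have "y + y = 2 *\<^sub>R f y"
    using y by (simp add: scaleR_2)
  then have "y + y = b + y * y"
    by (simp add: f_def)
  then have sq: "(1 - y) * (1 - y) = 1 - b"
    by (simp add: algebra_simps)
  have sy: "star y = y" and comm: "c * b = b * c \<Longrightarrow> c * y = y * c" for c
    using y(1) unfolding Y_def by blast+
  have "c * (1 - y) = (1 - y) * c" if "c * b = b * c" for c
    using comm[OF that] by (simp add: algebra_simps)
  moreover have "star (1 - y) = 1 - y"
    by (simp add: star_diff sy)
  ultimately show ?thesis
    using that sq by blast
qed

lemma scaleC_one [simp]: "scaleC 1 (a::'a::cstar_algebra) = a"
  using scaleC_of_real[of 1 a] by simp

lemma scaleC_minus_one [simp]: "scaleC (-1) (a::'a::cstar_algebra) = - a"
  using scaleC_of_real[of "-1" a] by simp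

lemma scaleC_minus_left: "scaleC (-c) (a::'a::cstar_algebra) = - scaleC c a"
  using scaleC_scaleC[of "-1" c a] by simp

lemma scaleC_diff_right: "scaleC c ((a::'a::cstar_algebra) - b) = scaleC c a - scaleC c b"
  using scaleC_add_right[of c "a - b" b] by simp

lemma scaleC_0_right [simp]: "scaleC c (0::'a::cstar_algebra) = 0"
  using scaleC_diff_right[of c "0::'a" 0] by simp

lemma scaleC_of_real_one: "scaleC (complex_of_real r) 1 = (of_real r :: 'a::cstar_algebra)"
  by (metis scaleC_of_real of_real_def)

text \<open>The double-angle formula: if \<open>c\<close> is the cosine, then
  \<open>u = c + i s\<close> with \<open>s\<close> a root of \<open>1 - c * c\<close> is unitary,
  and \<open>2 c * c - 1\<close> is the real part of \<open>u * u\<close>. It gives the bound that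
  makes squares positive.\<close>

lemma norm_double_square_minus_one:
  fixes a :: "'a::cstar_algebra"
  assumes a: "star a = a" "norm a \<le> 1"
  shows "norm (2 *\<^sub>R (a * a) - 1) \<le> 1"
proof -
  have lt: "norm (2 *\<^sub>R (c * c) - 1) \<le> 1" if c: "star c = c" "norm c < 1" for c :: 'a
  proof -
    have "norm (c * c) < 1"
      using c by (simp add: norm_selfadjoint_square abs_square_less_1)
    moreover have "star (c * c) = c * c" "c * (c * c) = c * c * c"
      using c by (simp_all add: star_mult mult.assoc)
    ultimately obtain s where s: "star s = s" "s * s = 1 - c * c" "c * s = s * c"
      using sqrt_one_minus_selfadjoint[of "c * c"] by metis
    define u where "u = c + scaleC \<i> s"
    have su: "star u = c - scaleC \<i> s"
      using c s by (simp add: u_def star_add star_scaleC scaleC_minus_left)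
    have "star u * u = 1"
      unfolding su using s
      by (simp add: u_def algebra_simps mult_scaleC_left mult_scaleC_right scaleC_scaleC
          scaleC_diff_right)
    then have "norm u = 1"
      using cstar_identity[of u] power2_eq_imp_eq[of "norm u" 1] by simp
    then have "norm (u * u) \<le> 1" "norm (star u * star u) \<le> 1"
      using norm_mult_ineq[of u u] norm_mult_ineq[of "star u" "star u"] by simp_all
    moreover have "u * u + star u * star u = 2 *\<^sub>R (c * c - s * s)"
      unfolding su
      by (simp add: u_def algebra_simps mult_scaleC_left mult_scaleC_right scaleC_scaleC scaleR_2
          scaleC_diff_right scaleC_add_right)
    then have "2 *\<^sub>R (c * c) - 1 = (1/2) *\<^sub>R (u * u + star u * star u)"
      using s(2) by (simp add: scaleR_2)
    ultimately show ?thesis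
      using norm_triangle_ineq[of "u * u" "star u * star u"] by simp
  qed
  \<comment> \<open>For norm exactly 1 the root of \<open>1 - a * a\<close> is not supplied by the
    contraction, so \<open>a\<close> is approached by \<open>r a\<close> with \<open>r\<close>
    increasing to 1.\<close>
  have "((\<lambda>r. norm (2 *\<^sub>R ((r *\<^sub>R a) * (r *\<^sub>R a)) - 1)) \<longlongrightarrow> norm (2 *\<^sub>R ((1 *\<^sub>R a) * (1 *\<^sub>R a)) - 1)) (at_left (1::real))"
    by (intro tendsto_intros)
  moreover have "eventually (\<lambda>r. norm (2 *\<^sub>R ((r *\<^sub>R a) * (r *\<^sub>R a)) - 1) \<le> 1) (at_left (1::real))"
    using eventually_at_left_real[of 0 1, simplified]
  proof (eventually_elim)
    case (elim r)
    then have "r * norm a \<le> r * 1" and "r < 1"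
      using a by (auto intro!: mult_left_mono)
    then have "r * norm a < 1"
      by linarith
    with elim show ?case
      using a by (intro lt) auto
  qed
  ultimately show ?thesis
    using tendsto_upperbound[of _ _ "at_left (1::real)"] by simp
qed


text \<open>For self-adjoint \<open>a\<close> the inequality places the spectrum in the interval
  from 0 to \<open>2 t\<close>. The existential \<open>t\<close> makes sums easy, since witnesses
  add; \<open>npos_norm_minus\<close> later allows the canonical choice \<open>t = norm a\<close>,
  which makes limits easy.\<close>

definition npos :: "'a::cstar_algebra \<Rightarrow> bool" where
  "npos a \<longleftrightarrow> star a = a \<and> (\<exists>t. norm (of_real t - a) \<le> t)"

lemma npos_selfadjoint: "npos a \<Longrightarrow> star a = a"
  by (simp add: npos_def)

lemma npos_of_real [simp]: "r \<ge> 0 \<Longrightarrow> npos (of_real r)"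
  by (auto simp: npos_def intro!: exI[of _ r])

lemma npos_0 [simp]: "npos 0"
  using npos_of_real[of 0] by simp

lemma npos_add:
  assumes "npos a" "npos b"
  shows "npos (a + b)"
proof -
  obtain s t where "norm (of_real s - a) \<le> s" "norm (of_real t - b) \<le> t"
    using assms by (auto simp: npos_def)
  then have "norm ((of_real s - a) + (of_real t - b)) \<le> s + t"
    by (intro norm_triangle_le add_mono)
  then show ?thesis
    using assms by (auto simp: npos_def star_add algebra_simps intro!: exI[of _ "s + t"])
qed

lemma npos_scaleR:
  assumes "npos a" "r \<ge> 0"
  shows "npos (r *\<^sub>R a)"
proof -
  obtain t where t: "norm (of_real t - a) \<le> t"
    using assms by (auto simp: npos_def)
  have "of_real (r * t) - r *\<^sub>R a = r *\<^sub>R (of_real t - a)"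
    by (simp add: scaleR_conv_of_real algebra_simps)
  then have "norm (of_real (r * t) - r *\<^sub>R a) \<le> r * t"
    using t assms by (simp add: mult_left_mono)
  then have "\<exists>t. norm (of_real t - r *\<^sub>R a) \<le> t"
    by blast
  then show ?thesis
    using assms by (simp add: npos_def)
qed

lemma norm_of_real_minus_square:
  fixes a :: "'a::cstar_algebra"
  assumes a: "star a = a" and t: "norm a ^ 2 \<le> t"
  shows "norm (of_real t - a * a) \<le> t"
proof (cases "t = 0")
  case False
  then have t0: "t > 0"
    using t by (smt (verit) zero_le_power2)
  define c where "c = (1 / sqrt t) *\<^sub>R a"
  have "norm a \<le> sqrt t"
    using t by (simp add: real_le_rsqrt)
  then have "norm (2 *\<^sub>R (c * c) - 1) \<le> 1"
    using a t0 by (intro norm_double_square_minus_one) (simp_all add: c_def)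
  moreover have "1 - (2 *\<^sub>R (c * c) - 1) = 2 *\<^sub>R (1 - c * c)"
    by (simp add: scaleR_2 algebra_simps)
  then have "(t / 2) *\<^sub>R (1 - (2 *\<^sub>R (c * c) - 1)) = t *\<^sub>R (1 - c * c)"
    by simp
  \<comment> \<open>Half of \<open>t\<close> times \<open>1 - (2 c * c - 1)\<close>, a factor of
    norm at most 2.\<close>
  then have "of_real t - a * a = (t / 2) *\<^sub>R (1 - (2 *\<^sub>R (c * c) - 1))"
    using t0 by (simp add: c_def scaleR_diff_right of_real_def)
  moreover have "norm (1 - (2 *\<^sub>R (c * c) - 1)) \<le> 1 + norm (2 *\<^sub>R (c * c) - 1)"
    using norm_triangle_ineq4[of 1 "2 *\<^sub>R (c * c) - 1"] by simp
  ultimately show ?thesis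
    using t0 by simp
qed (use t in simp)

lemma npos_square: "star a = a \<Longrightarrow> npos (a * a)"
  using norm_of_real_minus_square[of a] by (auto simp: npos_def star_mult)

text \<open>The shift by \<open>e\<close> makes \<open>(t - a) / (t + e)\<close> strictly smaller
  than 1 in norm, so that \<open>a + e = (t + e) (1 - b)\<close> falls under the contraction
  argument. Uses of this lemma remove \<open>e\<close> by a limit.\<close>

lemma npos_obtain_sqrt:
  assumes a: "npos a" and e: "e > 0"
  obtains s where "star s = s" "s * s = a + of_real e" "\<And>c. c * a = a * c \<Longrightarrow> c * s = s * c"
proof -
  obtain t where t: "norm (of_real t - a) \<le> t"
    using a by (auto simp: npos_def)
  then have t0: "t \<ge> 0"
    using norm_ge_zero order_trans by blast
  define b where "b = (1 / (t + e)) *\<^sub>R (of_real t - a)"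
  have "star b = b"
    using a by (simp add: b_def npos_def star_diff)
  moreover have "norm b < 1"
    using t t0 e unfolding b_def norm_scaleR by simp
  ultimately obtain s where s: "star s = s" "s * s = 1 - b"
    "\<And>c. c * b = b * c \<Longrightarrow> c * s = s * c"
    using sqrt_one_minus_selfadjoint by metis
  define s' where "s' = sqrt (t + e) *\<^sub>R s"
  have "s' * s' = (t + e) *\<^sub>R (1 - b)"
    using s(2) t0 e by (simp add: s'_def)
  also have "\<dots> = a + of_real e"
    using t0 e by (simp add: b_def algebra_simps) (simp add: of_real_def algebra_simps)
  finally have "s' * s' = a + of_real e" .
  moreover have "c * s' = s' * c" if "c * a = a * c" for c
  proof -
    have "c * b = b * c"
      using that by (simp add: b_def algebra_simps of_real_def)
    then show ?thesis
      using s(3)[of c] by (simp add: s'_def)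
  qed
  moreover have "star s' = s'"
    using s(1) by (simp add: s'_def)
  ultimately show ?thesis
    using that by blast
qed

text \<open>Writing \<open>a + e\<close> as a square \<open>s * s\<close> with
  \<open>norm s ^ 2\<close> at most \<open>norm a + e\<close> exchanges an arbitrary witness for
  \<open>norm a + e\<close>; then \<open>e\<close> tends to 0.\<close>

lemma npos_norm_minus:
  assumes "npos a"
  shows "norm (of_real (norm a) - a) \<le> norm a"
proof (rule field_le_epsilon)
  fix e :: real assume "e > 0"
  then obtain s where s: "star s = s" "s * s = a + of_real e"
    using npos_obtain_sqrt[OF assms] by metis
  have "norm s ^ 2 = norm (s * s)"
    by (rule norm_selfadjoint_square[OF s(1), symmetric])
  also have "\<dots> \<le> norm a + e"
    using s \<open>e > 0\<close> norm_triangle_ineq[of a "of_real e"] by simp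
  finally have "norm (of_real (norm a + e) - s * s) \<le> norm a + e"
    using s norm_of_real_minus_square by blast
  then show "norm (of_real (norm a) - a) \<le> norm a + e"
    using s by (simp add: algebra_simps)
qed

lemma npos_LIMSEQ:
  assumes "X \<longlonglongrightarrow> a" "\<And>n. npos (X n)"
  shows "npos a"
proof -
  have "(\<lambda>n. star (X n)) \<longlonglongrightarrow> star a"
    using assms by (intro bounded_linear.tendsto[OF bounded_linear_star])
  then have "star a = a"
    using assms LIMSEQ_unique by (auto simp: npos_def)
  moreover have "norm (of_real (norm a) - a) \<le> norm a"
  proof (rule LIMSEQ_le)
    show "(\<lambda>n. norm (of_real (norm (X n)) - X n)) \<longlonglongrightarrow> norm (of_real (norm a) - a)"
      "(\<lambda>n. norm (X n)) \<longlonglongrightarrow> norm a"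
      using assms(1) by (intro tendsto_intros; assumption)+
  qed (use assms npos_norm_minus in auto)
  ultimately show ?thesis
    by (auto simp: npos_def)
qed

text \<open>The quadratic shape is that of \<open>(a + e) (b + e)\<close>, the perturbed product in
  \<open>npos_mult\<close>.\<close>

lemma npos_limit_eps:
  assumes "\<And>e. e > 0 \<Longrightarrow> npos (a + e *\<^sub>R b + (e ^ 2) *\<^sub>R c)"
  shows "npos a"
proof (rule npos_LIMSEQ)
  have e: "(\<lambda>n. 1 / real (Suc n)) \<longlonglongrightarrow> 0"
    using LIMSEQ_inverse_real_of_nat by (simp add: inverse_eq_divide)
  show "(\<lambda>n. a + (1 / real (Suc n)) *\<^sub>R b + ((1 / real (Suc n)) ^ 2) *\<^sub>R c) \<longlonglongrightarrow> a"
    using tendsto_add[OF tendsto_add[OF tendsto_const[of a] tendsto_scaleR[OF e tendsto_const[of b]]]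
        tendsto_scaleR[OF tendsto_power[OF e, of 2] tendsto_const[of c]]] by simp
qed (use assms in auto)

lemma npos_mult:
  assumes "npos a" "npos b" "a * b = b * a"
  shows "npos (a * b)"
proof (rule npos_limit_eps[where b = "a + b" and c = 1])
  fix e :: real assume "e > 0"
  obtain c where c: "star c = c" "c * c = a + of_real e" "\<And>z. z * a = a * z \<Longrightarrow> z * c = c * z"
    using npos_obtain_sqrt[OF assms(1) \<open>e > 0\<close>] by metis
  obtain d where d: "star d = d" "d * d = b + of_real e" "\<And>z. z * b = b * z \<Longrightarrow> z * d = d * z"
    using npos_obtain_sqrt[OF assms(2) \<open>e > 0\<close>] by metis
  \<comment> \<open>Two applications of the commutant property: \<open>a\<close> commutes with
    \<open>b\<close>, hence with \<open>d\<close>; so \<open>d\<close> commutes with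
    \<open>a\<close>, hence with \<open>c\<close>.\<close>
  have cd: "c * d = d * c"
    using assms(3) c(3) d(3) by metis
  have "c * d * (c * d) = (c * c) * (d * d)"
    using cd by (metis mult.assoc)
  also have "\<dots> = a * b + e *\<^sub>R (a + b) + e\<^sup>2 *\<^sub>R 1"
    by (simp add: c d of_real_def algebra_simps power2_eq_square)
  finally show "npos (a * b + e *\<^sub>R (a + b) + e\<^sup>2 *\<^sub>R 1)"
    using npos_square[of "c * d"] c(1) d(1) cd by (simp add: star_mult)
qed

text \<open>The real part of \<open>c + i d\<close> has at most its norm, whose square is that of \<open>c\<^sup>2 + d\<^sup>2\<close>.\<close>

lemma norm_square_le_sum_squares:
  fixes c d :: "'a::cstar_algebra"
  assumes c: "star c = c" and d: "star d = d" and cd: "c * d = d * c"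
  shows "norm (c * c) \<le> norm (c * c + d * d)"
proof -
  define z where "z = c + scaleC \<i> d"
  have sz: "star z = c - scaleC \<i> d"
    using c d by (simp add: z_def star_add star_scaleC scaleC_minus_left)
  have "star z * z = c * c + d * d"
    unfolding sz using cd
    by (simp add: z_def algebra_simps mult_scaleC_left mult_scaleC_right scaleC_scaleC
        scaleC_diff_right)
  then have "norm (c * c + d * d) = norm z ^ 2"
    using cstar_identity[of z] by simp
  moreover have "c = (1/2) *\<^sub>R (z + star z)"
    unfolding sz by (simp add: z_def flip: scaleR_2)
  then have "norm c \<le> norm z"
    using norm_triangle_ineq[of z "star z"] norm_scaleR[of "1/2" "z + star z"] by simp
  ultimately show ?thesis
    using c by (simp add: norm_selfadjoint_square power_mono)
qed

text \<open>The commuting case has to come first: \<open>norm_attained\<close> depends on it, and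
  the general \<open>npos_norm_mono\<close> depends on \<open>norm_attained\<close>.\<close>

lemma norm_mono_commuting:
  assumes "npos a" "npos b" "a * b = b * a"
  shows "norm a \<le> norm (a + b)"
proof (rule field_le_epsilon)
  fix \<epsilon> :: real assume "\<epsilon> > 0"
  \<comment> \<open>One \<open>e\<close> is lost in passing from \<open>a\<close> to
    \<open>a + e\<close>, and two in passing from \<open>a + b\<close> to
    \<open>(a + e) + (b + e)\<close>.\<close>
  define e where "e = \<epsilon> / 3"
  have e: "e > 0"
    using \<open>\<epsilon> > 0\<close> by (simp add: e_def)
  obtain c where c: "star c = c" "c * c = a + of_real e" "\<And>z. z * a = a * z \<Longrightarrow> z * c = c * z"
    using npos_obtain_sqrt[OF assms(1) e] by metis
  obtain d where d: "star d = d" "d * d = b + of_real e" "\<And>z. z * b = b * z \<Longrightarrow> z * d = d * z"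
    using npos_obtain_sqrt[OF assms(2) e] by metis
  have "c * d = d * c"
    using assms(3) c(3) d(3) by metis
  then have "norm (c * c) \<le> norm (c * c + d * d)"
    using c d by (intro norm_square_le_sum_squares)
  also have "\<dots> = norm (a + b + of_real (e + e))"
    by (simp only: c d of_real_add add_ac)
  also have "\<dots> \<le> norm (a + b) + (e + e)"
    using norm_triangle_ineq[of "a + b" "of_real (e + e)"] e by (simp only: norm_of_real)
  finally show "norm a \<le> norm (a + b) + \<epsilon>"
    using norm_triangle_ineq4[of "a + of_real e" "of_real e"] e by (simp add: c e_def)
qed

section \<open>Invertible elements and the spectrum\<close>

definition unit_elem :: "'a::cstar_algebra \<Rightarrow> bool" where
  "unit_elem a \<longleftrightarrow> (\<exists>b. b * a = 1 \<and> a * b = 1)"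

lemma unit_elemI:
  assumes "l * a = 1" "a * r = 1"
  shows "unit_elem a"
proof -
  have "l = l * (a * r)"
    using assms by simp
  also have "\<dots> = r"
    unfolding mult.assoc[symmetric] using assms by simp
  finally show ?thesis
    using assms by (auto simp: unit_elem_def)
qed

lemma unit_elem_mult:
  assumes "unit_elem a" "unit_elem b"
  shows "unit_elem (a * b)"
proof -
  obtain c d where "c * a = 1" "a * c = 1" "d * b = 1" "b * d = 1"
    using assms by (auto simp: unit_elem_def)
  then have "d * c * (a * b) = 1" "a * b * (d * c) = 1"
    by (metis mult.assoc mult_1_right)+
  then show ?thesis
    by (auto simp: unit_elem_def)
qed

lemma unit_elem_scaleR: "unit_elem a \<Longrightarrow> r \<noteq> 0 \<Longrightarrow> unit_elem (r *\<^sub>R a)"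
  unfolding unit_elem_def by (metis mult_scaleR_left mult_scaleR_right right_inverse scaleR_one scaleR_scaleR)

lemma unit_elem_scaleC:
  assumes "unit_elem a" "c \<noteq> 0"
  shows "unit_elem (scaleC c a)"
proof -
  obtain b where "b * a = 1" "a * b = 1"
    using assms by (auto simp: unit_elem_def)
  then show ?thesis
    using assms unfolding unit_elem_def
    by (intro exI[of _ "scaleC (1 / c) b"]) (simp add: mult_scaleC_left mult_scaleC_right scaleC_scaleC)
qed

text \<open>In place of a Neumann series, the fixed points of \<open>x = 1 + b x\<close> and
  \<open>y = 1 + y b\<close> give a right and a left inverse, and these must coincide.\<close>

lemma unit_elem_one_minus:
  fixes b :: "'a::cstar_algebra"
  assumes "norm b < 1"
  shows "unit_elem (1 - b)"
proof -
  have "\<exists>!x. 1 + b * x = x"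
    using assms norm_mult_ineq[of b]
    by (intro banach_fix_type[where c = "norm b"]) (auto simp: dist_norm simp flip: right_diff_distrib)
  then obtain x where x: "1 + b * x = x"
    by blast
  have "\<exists>!y. 1 + y * b = y"
    using assms norm_mult_ineq[of _ b]
    by (intro banach_fix_type[where c = "norm b"])
      (auto simp: dist_norm mult.commute[of "norm b"] simp flip: left_diff_distrib)
  then obtain y where y: "1 + y * b = y"
    by blast
  have *: "(1 - b) * x = 1" "y * (1 - b) = 1"
    using x y by (simp_all add: algebra_simps)
  then show ?thesis
    by (intro unit_elemI)
qed

lemma unit_elem_of_real_minus:
  fixes b :: "'a::cstar_algebra"
  assumes "norm b < t"
  shows "unit_elem (of_real t - b)"
proof -
  have "t > 0"
    using assms norm_ge_zero[of b] by linarith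
  then have "unit_elem (t *\<^sub>R (1 - (1 / t) *\<^sub>R b))"
    using assms by (intro unit_elem_scaleR unit_elem_one_minus) (simp_all add: field_simps)
  then show ?thesis
    using \<open>t > 0\<close> by (simp add: of_real_def algebra_simps)
qed

text \<open>\<open>a + r\<close> equals \<open>(norm a + r) - (norm a - a)\<close>, and the
  subtracted element has norm at most \<open>norm a\<close>.\<close>

lemma npos_unit_elem:
  assumes "npos a" "r > 0"
  shows "unit_elem (a + of_real r)"
proof -
  have "unit_elem (of_real (norm a + r) - (of_real (norm a) - a))"
    using npos_norm_minus[OF assms(1)] assms(2) by (intro unit_elem_of_real_minus) simp
  then show ?thesis
    by (simp add: algebra_simps)
qed

text \<open>If \<open>e = \<parallel>a\<parallel>\<^sup>2 - a\<^sup>2\<close> were invertible, then \<open>e \<ge> \<delta>\<close> for some \<open>\<delta> > 0\<close>, so that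
  \<open>a\<^sup>2 \<le> \<parallel>a\<parallel>\<^sup>2 - \<delta>\<close>.\<close>

lemma norm_attained:
  fixes a :: "'a::cstar_algebra"
  assumes a: "star a = a"
  shows "\<not> (unit_elem (of_real (norm a) - a) \<and> unit_elem (of_real (norm a) + a))"
proof
  define n where "n = norm a ^ 2"
  define e where "e = of_real n - a * a"
  have na: "norm (a * a) = n"
    using a by (simp add: n_def norm_selfadjoint_square)
  have se: "star e = e"
    using a by (simp add: e_def star_diff star_mult)
  have pe: "npos e"
    using se na by (auto simp: npos_def e_def intro!: exI[of _ n])
  assume "unit_elem (of_real (norm a) - a) \<and> unit_elem (of_real (norm a) + a)"
  then have "unit_elem ((of_real (norm a) - a) * (of_real (norm a) + a))"
    by (intro unit_elem_mult) auto
  also have "(of_real (norm a) - a) * (of_real (norm a) + a) = e"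
    by (simp add: e_def n_def of_real_def algebra_simps power2_eq_square)
  finally obtain g where g: "g * e = 1" "e * g = 1"
    by (auto simp: unit_elem_def)
  have sg: "star g = g"
    using g se by (metis star_1 star_mult mult.assoc mult_1_left mult_1_right)
  show False
  proof (cases "n = 0")
    case True
    then have "e = 0"
      using na by (simp add: e_def)
    then show False
      using g by simp
  next
    case False
    then have n: "n > 0"
      using na norm_ge_zero[of "a * a"] by linarith
    have "g \<noteq> 0"
      using g by force
    \<comment> \<open>The bound \<open>n / 2\<close> keeps \<open>n - \<delta>\<close> positive; the
      bound \<open>1 / norm g\<close> makes \<open>1 - \<delta> g\<close> positive. Since
      \<open>g\<close> inverts \<open>e\<close>, the product \<open>e (1 - \<delta> g)\<close> is
      \<open>e - \<delta>\<close>, that is \<open>(n - \<delta>) - a * a\<close>.\<close>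
    define \<delta> where "\<delta> = min (n / 2) (1 / norm g)"
    have \<delta>: "\<delta> > 0" "\<delta> < n" "\<delta> * norm g \<le> 1"
      using n \<open>g \<noteq> 0\<close> by (auto simp: \<delta>_def min_def field_simps)
    have "npos (1 - \<delta> *\<^sub>R g)"
      using sg \<delta> by (auto simp: npos_def star_diff intro!: exI[of _ 1])
    moreover have "e * (1 - \<delta> *\<^sub>R g) = (1 - \<delta> *\<^sub>R g) * e"
      using g by (simp add: algebra_simps)
    ultimately have "npos (e * (1 - \<delta> *\<^sub>R g))"
      using pe by (intro npos_mult)
    then have "npos (of_real (n - \<delta>) - a * a)"
      using g by (simp add: e_def[symmetric] algebra_simps of_real_def) (simp add: e_def of_real_def algebra_simps)
    moreover have "a * a * (of_real (n - \<delta>) - a * a) = (of_real (n - \<delta>) - a * a) * (a * a)"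
      by (simp add: of_real_def algebra_simps)
    ultimately have "norm (a * a) \<le> norm (a * a + (of_real (n - \<delta>) - a * a))"
      using npos_square[OF a] by (intro norm_mono_commuting)
    also have "\<dots> = n - \<delta>"
      using \<delta> norm_of_real[of "n - \<delta>", where 'a = 'a] by simp
    finally show False
      using \<delta> na by simp
  qed
qed

text \<open>If \<open>norm a\<close> exceeded \<open>e\<close>, adding the gap to
  \<open>e - a\<close> and \<open>e + a\<close> would make both \<open>norm a - a\<close> and
  \<open>norm a + a\<close> invertible, against \<open>norm_attained\<close>.\<close>

lemma norm_le_of_npos:
  assumes "star a = a" "npos (of_real e - a)" "npos (of_real e + a)"
  shows "norm a \<le> e"
proof (rule ccontr)
  assume "\<not> norm a \<le> e"
  then have "norm a - e > 0"
    by simp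
  from npos_unit_elem[OF assms(2) this] npos_unit_elem[OF assms(3) this] norm_attained[OF assms(1)]
  show False
    by (simp add: algebra_simps)
qed

lemma npos_norm_minus_selfadjoint: "star a = a \<Longrightarrow> npos (of_real (norm a) - a)"
  by (auto simp: npos_def star_diff intro!: exI[of _ "norm a"])

lemma npos_norm_mono:
  assumes "npos a" "npos (b - a)"
  shows "norm a \<le> norm b"
proof (rule norm_le_of_npos)
  have b: "star b = b"
    using assms npos_add npos_selfadjoint by fastforce
  show "npos (of_real (norm b) - a)"
    using npos_add[OF npos_norm_minus_selfadjoint[OF b] assms(2)] by simp
  show "npos (of_real (norm b) + a)"
    using assms by (intro npos_add) auto
qed (use assms npos_selfadjoint in auto)

lemma npos_antisym: "npos a \<Longrightarrow> npos (- a) \<Longrightarrow> a = 0"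
  using norm_le_of_npos[of a 0] by (simp add: npos_selfadjoint)

lemma cspectrum_iff: "c \<in> cspectrum a \<longleftrightarrow> \<not> unit_elem (a - scaleC c 1)"
  by (simp add: cspectrum_def unit_elem_def)

lemma unit_elem_minus: "unit_elem (- a) \<longleftrightarrow> unit_elem a"
  using unit_elem_scaleR[of a "-1"] unit_elem_scaleR[of "- a" "-1"] by auto

text \<open>With \<open>b = a - Re z\<close>, the two factors \<open>b - i Im z\<close> and
  \<open>b + i Im z\<close> multiply in either order to \<open>b * b + (Im z)\<^sup>2\<close>, a
  positive element plus a positive real, hence invertible.\<close>

lemma unit_elem_selfadjoint_minus:
  fixes a :: "'a::cstar_algebra"
  assumes a: "star a = a" and z: "Im z \<noteq> 0"
  shows "unit_elem (a - scaleC z 1)"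
proof -
  define b where "b = a - of_real (Re z)"
  have sb: "star b = b"
    using a by (simp add: b_def star_diff)
  have "unit_elem (b * b + of_real ((Im z)\<^sup>2))"
    using z by (intro npos_unit_elem npos_square sb) simp
  moreover have eq: "a - scaleC z 1 = b - scaleC (\<i> * Im z) 1"
    by (subst complex_eq[of z]) (simp add: b_def scaleC_add_left scaleC_of_real_one)
  ultimately obtain g where g: "g * (b * b + of_real ((Im z)\<^sup>2)) = 1" "(b * b + of_real ((Im z)\<^sup>2)) * g = 1"
    by (auto simp: unit_elem_def)
  have sq: "scaleC (\<i> * Im z) (scaleC (\<i> * Im z) 1) = - (of_real ((Im z)\<^sup>2) :: 'a)"
  proof -
    have "\<i> * Im z * (\<i> * Im z) = complex_of_real (- ((Im z)\<^sup>2))"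
      by (simp add: power2_eq_square complex_eq_iff)
    then show ?thesis
      by (simp only: scaleC_scaleC of_real_minus scaleC_minus_left scaleC_of_real_one)
  qed
  have m1: "(b - scaleC (\<i> * Im z) 1) * (b + scaleC (\<i> * Im z) 1) = b * b + of_real ((Im z)\<^sup>2)"
    and m2: "(b + scaleC (\<i> * Im z) 1) * (b - scaleC (\<i> * Im z) 1) = b * b + of_real ((Im z)\<^sup>2)"
    using sq by (simp_all add: algebra_simps mult_scaleC_left mult_scaleC_right scaleC_diff_right
        scaleC_add_right)
  have "(b - scaleC (\<i> * Im z) 1) * ((b + scaleC (\<i> * Im z) 1) * g) = 1"
    using m1 g by (simp flip: mult.assoc)
  moreover have "(g * (b + scaleC (\<i> * Im z) 1)) * (b - scaleC (\<i> * Im z) 1) = 1"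
    using m2 g by (simp add: mult.assoc)
  ultimately show ?thesis
    unfolding eq by (intro unit_elemI)
qed

text \<open>From spectrum to norm, let \<open>c = norm a - a\<close> and suppose
  \<open>norm c > norm a\<close>. If \<open>norm c\<close> were spectral for \<open>c\<close>, the
  negative number \<open>norm a - norm c\<close> would be spectral for \<open>a\<close>; if
  \<open>- norm c\<close> were, then \<open>norm a + norm c\<close> would be, which is too large.
  Conversely, the spectrum is real and \<open>npos_unit_elem\<close> excludes its negative
  part.\<close>

lemma cstar_positive_iff_npos: "cstar_positive a \<longleftrightarrow> npos a"
proof
  assume P: "cstar_positive a"
  then have sa: "star a = a" and sp: "\<And>c. c \<in> cspectrum a \<Longrightarrow> c \<in> complex_of_real ` {0..}"
    by (auto simp: cstar_positive_def)
  define c where "c = of_real (norm a) - a"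
  have sc: "star c = c"
    using sa by (simp add: c_def star_diff)
  have "norm c \<le> norm a"
  proof (rule ccontr)
    assume "\<not> norm c \<le> norm a"
    then have gt: "norm c > norm a"
      by simp
    have "of_real (norm a - norm c) \<notin> cspectrum a"
    proof
      assume "of_real (norm a - norm c) \<in> cspectrum a"
      then obtain t where "complex_of_real (norm a - norm c) = of_real t" "t \<ge> 0"
        using sp by blast
      then show False
        using gt unfolding of_real_eq_iff by simp
    qed
    then have "unit_elem (- (a - of_real (norm a - norm c)))"
      unfolding cspectrum_iff scaleC_of_real_one unit_elem_minus by blast
    moreover have "- (a - of_real (norm a - norm c)) = c - of_real (norm c)"
      by (simp add: c_def)
    ultimately have 1: "unit_elem (of_real (norm c) - c)"
      using unit_elem_minus[of "of_real (norm c) - c"] by (simp only: minus_diff_eq)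
    have "unit_elem (of_real (norm a + norm c) - a)"
      using gt norm_ge_zero[of a] by (intro unit_elem_of_real_minus) linarith
    then have "unit_elem (of_real (norm c) + c)"
      by (simp add: c_def algebra_simps)
    with 1 norm_attained[OF sc] show False
      by simp
  qed
  then show "npos a"
    using sa by (auto simp: npos_def c_def)
next
  assume P: "npos a"
  then have sa: "star a = a"
    by (rule npos_selfadjoint)
  have "z \<in> complex_of_real ` {0..}" if z: "z \<in> cspectrum a" for z
  proof -
    have "Im z = 0"
      using unit_elem_selfadjoint_minus[OF sa, of z] z by (auto simp: cspectrum_iff)
    then have zr: "z = of_real (Re z)"
      by (simp add: complex_eq_iff)
    then have "\<not> unit_elem (a + of_real (- Re z))"
      using z unfolding cspectrum_iff by (metis scaleC_of_real_one diff_conv_add_uminus of_real_minus)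
    then have "Re z \<ge> 0"
      using npos_unit_elem[OF P, of "- Re z"] by linarith
    then show ?thesis
      using zr by (metis atLeast_iff imageI)
  qed
  then show "cstar_positive a"
    using sa by (auto simp: cstar_positive_def)
qed


section \<open>Positivity of \<open>star x * x\<close>\<close>

lemma unit_elem_one_minus_mult_commute:
  assumes "unit_elem (1 - a * b)"
  shows "unit_elem (1 - b * a)"
proof -
  obtain c where c: "c * (1 - a * b) = 1" "(1 - a * b) * c = 1"
    using assms by (auto simp: unit_elem_def)
  have c': "c * a * b = c - 1" "a * b * c = c - 1"
    using c by (simp_all add: algebra_simps)
  \<comment> \<open>The inverse is read off from the formal geometric series: the sum of the powers
    of \<open>b a\<close> is 1 plus \<open>b\<close> (sum of the powers of \<open>a b\<close>)
    \<open>a\<close>.\<close>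
  have "(1 + b * c * a) * (1 - b * a) = 1 - b * a + b * c * a - b * (c * a * b) * a"
    by (simp add: algebra_simps)
  also have "\<dots> = 1"
    unfolding c' by (simp add: algebra_simps)
  finally have 1: "(1 + b * c * a) * (1 - b * a) = 1" .
  have "(1 - b * a) * (1 + b * c * a) = 1 - b * a + b * c * a - b * (a * b * c) * a"
    by (simp add: algebra_simps)
  also have "\<dots> = 1"
    unfolding c' by (simp add: algebra_simps)
  finally show ?thesis
    using 1 by (auto simp: unit_elem_def)
qed

text \<open>\<open>star x * x\<close> and \<open>x * star x\<close> can differ in spectrum only at
  0. The shift moves this exceptional point to \<open>e\<close>, which is itself
  nonnegative.\<close>

lemma npos_mult_swap:
  fixes x :: "'a::cstar_algebra"
  assumes "npos (star x * x + of_real e)" "e > 0"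
  shows "npos (x * star x + of_real e)"
  unfolding cstar_positive_iff_npos[symmetric] cstar_positive_def
proof (intro conjI subsetI)
  show "star (x * star x + of_real e) = x * star x + of_real e"
    by (simp add: star_add star_mult star_star)
  fix z assume z: "z \<in> cspectrum (x * star x + of_real e)"
  show "z \<in> complex_of_real ` {0..}"
  proof (cases "z = of_real e")
    case False
    define w where "w = z - of_real e"
    have w: "w \<noteq> 0"
      using False by (simp add: w_def)
    have z_eq: "a + of_real e - scaleC z 1 = scaleC (- w) (1 - scaleC (1 / w) a)" for a :: 'a
      using w by (simp add: scaleC_diff_right scaleC_scaleC)
        (simp add: w_def scaleC_minus_left algebra_simps scaleC_of_real_one flip: scaleC_minus_left scaleC_add_left)
    have "\<not> unit_elem (1 - scaleC (1 / w) x * star x)"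
      using z w unit_elem_scaleC[of _ "- w"] unfolding cspectrum_iff z_eq mult_scaleC_left by fastforce
    then have "\<not> unit_elem (1 - star x * scaleC (1 / w) x)"
      using unit_elem_one_minus_mult_commute by blast
    moreover have "1 - star x * scaleC (1 / w) x
        = scaleC (- 1 / w) (star x * x + of_real e - scaleC z 1)"
      unfolding z_eq using w by (simp add: scaleC_scaleC mult_scaleC_right)
    ultimately have "z \<in> cspectrum (star x * x + of_real e)"
      using w unit_elem_scaleC[of _ "- 1 / w"] unfolding cspectrum_iff by fastforce
    then show ?thesis
      using assms(1) unfolding cstar_positive_iff_npos[symmetric] cstar_positive_def by blast
  qed (use assms in auto)
qed

text \<open>The operator form of \<open>(m + 1) (1 - q) q^m \<le> 1\<close> for real
  \<open>q \<ge> 0\<close>. It is obtained without any bound on the norm of \<open>q\<close>; such a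
  bound is what \<open>npos_star_mult_self\<close> has to derive.\<close>

lemma npos_real_minus_commuting:
  fixes s :: "'a::cstar_algebra"
  assumes s: "star s = s"
  defines "q \<equiv> s * s"
  shows "npos (1 - real (Suc m) *\<^sub>R ((1 - q) * q ^ m))"
proof -
  have sq: "star q = q" "s ^ (2 * k) = q ^ k" for k
    using s by (simp_all add: q_def star_mult power_mult power2_eq_square)
  have comm: "s * q = q * s"
    by (simp add: q_def mult.assoc)
  have npos_pow: "npos (q ^ k)" for k
    using npos_square[of "s ^ k"] s sq(2)[of k]
    by (simp add: star_power mult_2 power_add)
  \<comment> \<open>A sharper inequality suited to induction: the left side is 0 for
    \<open>m = 0\<close> and grows by \<open>(m + 1) (1 - q)^2 q^m\<close> at each step, a multiple
    of the square of \<open>(1 - q) s^m\<close>.\<close>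
  have "npos (1 - q ^ Suc m - real (Suc m) *\<^sub>R ((1 - q) * q ^ m))"
  proof (induction m)
    case (Suc m)
    have "npos ((1 - q) * s ^ m * ((1 - q) * s ^ m))"
    proof (rule npos_square)
      have "s ^ m * (1 - q) = (1 - q) * s ^ m"
        using power_commuting_commutes[OF comm, of m] by (simp add: algebra_simps)
      then show "star ((1 - q) * s ^ m) = (1 - q) * s ^ m"
        using s sq by (simp add: star_mult star_diff star_power)
    qed
    moreover have "(1 - q) * s ^ m * ((1 - q) * s ^ m) = (1 - q) * (1 - q) * q ^ m"
    proof -
      have "s ^ m * (1 - q) = (1 - q) * s ^ m"
        using power_commuting_commutes[OF comm, of m] by (simp add: algebra_simps)
      then have "(1 - q) * s ^ m * ((1 - q) * s ^ m) = (1 - q) * (1 - q) * (s ^ m * s ^ m)"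
        by (metis mult.assoc)
      then show ?thesis
        using sq(2)[of m] by (simp add: mult_2 power_add)
    qed
    ultimately have "npos (real (Suc m) *\<^sub>R ((1 - q) * (1 - q) * q ^ m))"
      by (simp only: npos_scaleR of_nat_0_le_iff)
    then have "npos ((1 - q ^ Suc m - real (Suc m) *\<^sub>R ((1 - q) * q ^ m))
        + real (Suc m) *\<^sub>R ((1 - q) * (1 - q) * q ^ m))"
      using Suc by (intro npos_add)
    also have "(1 - q ^ Suc m - real (Suc m) *\<^sub>R ((1 - q) * q ^ m))
        + real (Suc m) *\<^sub>R ((1 - q) * (1 - q) * q ^ m)
      = 1 - q ^ Suc (Suc m) - real (Suc (Suc m)) *\<^sub>R ((1 - q) * q ^ Suc m)"
    proof -
      have "q * q ^ m = q ^ m * q"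
        by (simp add: power_commutes)
      then show ?thesis
        by (simp add: algebra_simps scaleR_2)
    qed
    finally show ?case .
  qed (simp add: q_def)
  from npos_add[OF this npos_pow[of "Suc m"]] show ?thesis
    by simp
qed

text \<open>Write \<open>x\<^sup>* x = M (1 - q)\<close> with \<open>\<parallel>1 - q\<parallel> < 1\<close> and \<open>y = x q\<^sup>m\<^sup>/\<^sup>2\<close>. Then
  \<open>y\<^sup>* y = M (1 - q) q\<^sup>m \<le> M / (m + 1)\<close>, and, since \<open>y\<^sup>* y + y y\<^sup>* \<ge> 0\<close> while \<open>y\<^sup>* y\<close> and \<open>y y\<^sup>*\<close> have
  the same nonzero spectrum, \<open>y\<^sup>* y \<ge> - M / (m + 1)\<close>. So \<open>(1 - q) q\<^sup>m\<close> stays bounded, which forces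
  \<open>\<parallel>q\<parallel> \<le> 1\<close>.\<close>

lemma npos_star_mult_self:
  fixes x :: "'a::cstar_algebra"
  shows "npos (star x * x)"
proof -
  define h where "h = star x * x"
  \<comment> \<open>The summand 1 makes \<open>h / M\<close> strictly smaller than 1 in norm, so
    \<open>1 - h / M\<close> has a root. Positivity of \<open>h\<close> then amounts to
    \<open>q \<le> 1\<close>.\<close>
  define M where "M = norm h + 1"
  define b where "b = (1 / M) *\<^sub>R h"
  have M: "M > 0" "norm h < M"
    using norm_ge_zero[of h] by (simp_all add: M_def add_nonneg_pos)
  have sh: "star h = h"
    by (simp add: h_def star_mult star_star)
  have b: "star b = b" "norm b < 1"
    using M sh by (simp_all add: b_def)
  obtain s where s: "star s = s" "s * s = 1 - b"
    using sqrt_one_minus_selfadjoint[OF b] by metis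
  define q where "q = s * s"
  have sq: "star q = q"
    using s(1) by (simp add: q_def star_mult)
  have h: "h = M *\<^sub>R (1 - q)"
    using s M by (simp add: q_def b_def)
  have bound: "norm ((1 - q) * q ^ m) \<le> 1" for m
  proof -
    define e where "e = M / real (Suc m)"
    have e: "e > 0"
      using M by (simp add: e_def)
    define y where "y = x * s ^ m"
    have "s * q = q * s"
      by (simp add: q_def mult.assoc)
    then have "s ^ m * (1 - q) = (1 - q) * s ^ m"
      using power_commuting_commutes[of s q m] by (simp add: algebra_simps)
    moreover have "star y * y = s ^ m * h * s ^ m"
      using s(1) by (simp add: y_def h_def star_mult star_power mult.assoc)
    ultimately have "star y * y = M *\<^sub>R ((1 - q) * (s ^ m * s ^ m))"
      by (simp add: h mult.assoc)
    moreover have "s ^ m * s ^ m = q ^ m"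
      by (metis mult_2 power2_eq_square power_add power_mult q_def)
    ultimately have yy: "star y * y = M *\<^sub>R ((1 - q) * q ^ m)"
      by simp
    have "npos (e *\<^sub>R (1 - real (Suc m) *\<^sub>R ((1 - q) * q ^ m)))"
      using npos_real_minus_commuting[OF s(1)] e by (intro npos_scaleR) (auto simp: q_def)
    then have ub: "npos (of_real e - star y * y)"
      using M unfolding yy by (simp add: e_def scaleR_diff_right of_real_def del: of_nat_Suc)
    \<comment> \<open>Real and imaginary part of \<open>y\<close>; twice the sum of their squares is
      \<open>star y * y + y * star y\<close>.\<close>
    define a c where "a = (1/2) *\<^sub>R (y + star y)" and "c = scaleC (- \<i> / 2) (y - star y)"
    have "star a = a" "star c = c"
      by (simp_all add: a_def c_def star_add star_diff star_scaleC star_star scaleC_diff_right scaleC_minus_left)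
    then have "npos (2 *\<^sub>R (a * a + c * c))"
      by (intro npos_scaleR npos_add npos_square) auto
    also have "2 *\<^sub>R (a * a + c * c) = star y * y + y * star y"
    proof -
      have "a * a = (1/4) *\<^sub>R ((y + star y) * (y + star y))"
        by (simp add: a_def)
      moreover have "c * c = (- 1/4) *\<^sub>R ((y - star y) * (y - star y))"
        using scaleC_of_real[of "- 1/4" "(y - star y) * (y - star y)"]
        by (simp add: c_def mult_scaleC_left mult_scaleC_right scaleC_scaleC)
      moreover have "(y + star y) * (y + star y) - (y - star y) * (y - star y) = 2 *\<^sub>R (star y * y + y * star y)"
        by (simp add: algebra_simps scaleR_2)
      ultimately have "2 *\<^sub>R (a * a + c * c) = (1/2) *\<^sub>R (2 *\<^sub>R (star y * y + y * star y))"
        by (simp flip: scaleR_diff_right)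
      then show ?thesis
        by simp
    qed
    \<comment> \<open>Adding the upper estimate cancels \<open>star y * y\<close> and leaves
      \<open>y * star y + e\<close>, which the spectral swap converts into a lower bound for
      \<open>star y * y\<close>.\<close>
    finally have "npos (star y * y + y * star y + (of_real e - star y * y))"
      using ub by (rule npos_add)
    then have "npos (star (star y) * star y + of_real e)"
      by (simp add: star_star algebra_simps)
    then have lb: "npos (of_real e + star y * y)"
      using npos_mult_swap[of "star y" e] e by (simp add: star_star algebra_simps)
    have "norm (star y * y) \<le> e"
      using ub lb by (intro norm_le_of_npos) (simp_all add: star_mult star_star)
    then have "norm ((1 - q) * q ^ m) \<le> 1 / real (Suc m)"
      using M mult_le_cancel_left_pos[OF M(1), of "norm ((1 - q) * q ^ m)" "1 / real (Suc m)"]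
      unfolding yy e_def norm_scaleR by simp
    also have "\<dots> \<le> 1"
      by simp
    finally show ?thesis .
  qed
  have "norm q \<le> 1"
  proof (rule ccontr)
    assume "\<not> norm q \<le> 1"
    then have gt: "norm q > 1"
      by simp
    then obtain m where m: "1 / (norm q - 1) < norm q ^ m"
      using real_arch_pow by blast
    have "norm q ^ Suc m = norm (q ^ Suc m)"
      using norm_selfadjoint_power[OF sq, of "Suc m"] by simp
    \<comment> \<open>Together with the uniform bound this gives
      \<open>norm q ^ m * (norm q - 1) \<le> 1\<close> for this \<open>m\<close>, which was chosen
      to violate it.\<close>
    also have "q ^ Suc m = q ^ m - (1 - q) * q ^ m"
      by (simp add: algebra_simps)
    also have "norm \<dots> \<le> norm q ^ m + 1"
      using norm_triangle_ineq4[of "q ^ m" "(1 - q) * q ^ m"] bound[of m]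
        norm_selfadjoint_power[OF sq, of m] by simp
    finally have "norm q ^ m * (norm q - 1) \<le> 1"
      by (simp add: algebra_simps)
    then show False
      using m gt by (simp add: field_simps)
  qed
  then have "npos (1 - q)"
    using sq by (auto simp: npos_def star_diff intro!: exI[of _ 1])
  then have "npos h"
    unfolding h using M by (intro npos_scaleR) auto
  then show ?thesis
    by (simp add: h_def)
qed

lemma npos_mult_star_self: "npos (x * star x)"
  using npos_star_mult_self[of "star x"] by (simp add: star_star)

lemma npos_conjugate:
  assumes "npos b"
  shows "npos (a * b * star a)"
proof (rule npos_limit_eps[where b = "a * star a" and c = 0])
  fix e :: real assume "e > 0"
  then obtain s where s: "star s = s" "s * s = b + of_real e"
    using npos_obtain_sqrt[OF assms] by metis
  have "a * b * star a + e *\<^sub>R (a * star a) + e\<^sup>2 *\<^sub>R 0 = a * (b + of_real e) * star a"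
    by (simp add: algebra_simps of_real_def)
  also have "\<dots> = (a * s) * star (a * s)"
    unfolding s(2)[symmetric] by (simp add: star_mult s(1) mult.assoc)
  finally show "npos (a * b * star a + e *\<^sub>R (a * star a) + e\<^sup>2 *\<^sub>R 0)"
    using npos_mult_star_self[of "a * s"] by simp
qed

text \<open>With \<open>p\<close>, \<open>b\<close>, \<open>q\<close> standing for
  \<open>\<langle>x,x\<rangle>\<close>, \<open>\<langle>x,y\<rangle>\<close>,
  \<open>\<langle>y,y\<rangle>\<close>, the first hypothesis is positivity of the form at
  \<open>x - a y\<close>. The abstract version serves the inner product, the form of a positive
  operator, and finite sums in the algebra.\<close>

lemma norm_Cauchy_Schwarz:
  fixes b p q :: "'a::cstar_algebra"
  assumes pos: "\<And>a. npos (p - a * star b - b * star a + a * q * star a)"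
    and p: "npos p" and q: "npos q"
  shows "norm b ^ 2 \<le> norm p * norm q"
proof -
  have *: "norm b ^ 2 \<le> norm p * t" if t: "t > 0" "norm q \<le> t" for t
  proof -
    have "npos (of_real t - q)"
      using npos_add[OF npos_norm_minus_selfadjoint[of q] npos_of_real[of "t - norm q"]] t q
      by (simp add: npos_selfadjoint)
    \<comment> \<open>The minimizing choice \<open>a = b / t\<close>; the second summand replaces
      \<open>q\<close> by \<open>t\<close>, so the quadratic term cancels one of the two copies of
      \<open>b * star b / t\<close>.\<close>
    from npos_add[OF pos[of "(1 / t) *\<^sub>R b"] npos_conjugate[OF this, of "(1 / t) *\<^sub>R b"]]
    have "npos (p - (1 / t) *\<^sub>R (b * star b))"
      using t by (simp add: algebra_simps of_real_def)
    moreover have "npos ((1 / t) *\<^sub>R (b * star b))"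
      using t by (intro npos_scaleR npos_mult_star_self) auto
    ultimately have "norm ((1 / t) *\<^sub>R (b * star b)) \<le> norm p"
      by (intro npos_norm_mono)
    moreover have "norm (b * star b) = norm b ^ 2"
      using cstar_identity[of "star b"] by (simp add: star_star)
    ultimately show ?thesis
      using t by (simp add: field_simps)
  qed
  show ?thesis
  proof (cases "norm p = 0")
    case True
    then show ?thesis
      using *[of "norm q + 1"] by (simp add: add_nonneg_pos)
  next
    case False
    then have np: "norm p > 0"
      by simp
    show ?thesis
    proof (rule field_le_epsilon)
      fix \<epsilon> :: real assume "\<epsilon> > 0"
      then show "norm b ^ 2 \<le> norm p * norm q + \<epsilon>"
        using *[of "norm q + \<epsilon> / norm p"] np by (simp add: add_nonneg_pos distrib_left)
    qed
  qed
qed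

section \<open>Order estimates for sums and series\<close>

lemma cstar_le_iff_npos: "cstar_le a b \<longleftrightarrow> npos (b - a)"
  by (simp add: cstar_le_def cstar_positive_iff_npos)

lemma npos_sum: "(\<And>j. j \<in> F \<Longrightarrow> npos (g j)) \<Longrightarrow> npos (sum g F)"
  by (induction F rule: infinite_finite_induct) (auto intro: npos_add)

lemma star_sum: "star (sum g F) = (\<Sum>j\<in>F. star (g j :: 'a::cstar_algebra))"
  by (induction F rule: infinite_finite_induct) (auto simp: star_add)

lemma star_sums: "g sums (s::'a::cstar_algebra) \<Longrightarrow> (\<lambda>j. star (g j)) sums star s"
  by (rule bounded_linear.sums[OF bounded_linear_star])

lemma npos_suminf_minus_sum:
  assumes g: "summable g" "\<And>j. npos (g j)" and F: "finite F"
  shows "npos (suminf g - sum g F)"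
proof -
  obtain M where M: "F \<subseteq> {..<M}"
    using F finite_nat_iff_bounded by blast
  have "(\<lambda>n. sum g {..<n + M} - sum g F) \<longlonglongrightarrow> suminf g - sum g F"
    by (intro tendsto_intros LIMSEQ_ignore_initial_segment summable_LIMSEQ g)
  moreover have "npos (sum g {..<n + M} - sum g F)" for n
  proof -
    have "F \<subseteq> {..<n + M}"
      using M by auto
    then have "sum g {..<n + M} - sum g F = sum g ({..<n + M} - F)"
      by (simp add: sum_diff)
    then show ?thesis
      using g by (simp add: npos_sum)
  qed
  ultimately show ?thesis
    by (rule npos_LIMSEQ)
qed

lemma norm_sum_Cauchy_Schwarz:
  fixes a c :: "nat \<Rightarrow> 'a::cstar_algebra"
  shows "norm (\<Sum>j\<in>F. a j * star (c j)) ^ 2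
    \<le> norm (\<Sum>j\<in>F. a j * star (a j)) * norm (\<Sum>j\<in>F. c j * star (c j))"
proof (rule norm_Cauchy_Schwarz)
  fix b :: 'a
  have "npos (\<Sum>j\<in>F. (a j - b * c j) * star (a j - b * c j))"
    by (intro npos_sum npos_mult_star_self)
  also have "(\<Sum>j\<in>F. (a j - b * c j) * star (a j - b * c j))
      = (\<Sum>j\<in>F. a j * star (a j) - b * (c j * star (a j)) - a j * star (c j) * star b
          + b * (c j * star (c j)) * star b)"
    by (intro sum.cong) (simp_all add: star_diff star_mult algebra_simps)
  also have "\<dots> = (\<Sum>j\<in>F. a j * star (a j)) - b * star (\<Sum>j\<in>F. a j * star (c j))
      - (\<Sum>j\<in>F. a j * star (c j)) * star b + b * (\<Sum>j\<in>F. c j * star (c j)) * star b"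
    by (simp add: star_sum star_mult star_star sum.distrib sum_subtractf sum_distrib_left
        sum_distrib_right mult.assoc)
  finally show "npos \<dots>" .
qed (intro npos_sum npos_mult_star_self)+

text \<open>Absolute convergence is not assumed; instead, each block of the subseries is dominated
  in order, hence in norm, by the same block of the full series.\<close>

lemma summable_subseries:
  assumes "summable g" "\<And>j. npos (g j)"
  shows "summable (\<lambda>j. if j \<in> J then g j else 0)"
  unfolding summable_Cauchy
proof (intro allI impI)
  fix e :: real assume "e > 0"
  then obtain N where N: "\<And>m n. m \<ge> N \<Longrightarrow> norm (sum g {m..<n}) < e"
    using assms(1) unfolding summable_Cauchy by blast
  have "norm (\<Sum>j\<in>{m..<n}. if j \<in> J then g j else 0) \<le> norm (sum g {m..<n})" for m n
  proof (rule npos_norm_mono)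
    have "sum g {m..<n} - (\<Sum>j\<in>{m..<n}. if j \<in> J then g j else 0)
        = (\<Sum>j\<in>{m..<n}. if j \<in> J then 0 else g j)"
      unfolding sum_subtractf[symmetric] by (intro sum.cong) auto
    then show "npos (sum g {m..<n} - (\<Sum>j\<in>{m..<n}. if j \<in> J then g j else 0))"
      using assms(2) by (auto intro!: npos_sum)
  qed (use assms(2) in \<open>auto intro!: npos_sum\<close>)
  then show "\<exists>N. \<forall>m\<ge>N. \<forall>n. norm (\<Sum>j\<in>{m..<n}. if j \<in> J then g j else 0) < e"
    using N by (meson order_le_less_trans)
qed

section \<open>Operators on a Hilbert module\<close>

context hilbert_module
begin

lemma ip_add_right: "ip x (y + z) = ip x y + ip x z"
  by (metis ip_add_left ip_star star_add)

lemma ip_smul_right: "ip x (smul a y) = ip x y * star a"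
  by (metis ip_smul_left ip_star star_mult)

lemma ip_0_left [simp]: "ip 0 x = 0"
  using ip_add_left[of 0 0 x] by simp

lemma ip_0_right [simp]: "ip x 0 = 0"
  using ip_add_right[of x 0 0] by simp

lemma ip_minus_left [simp]: "ip (- x) y = - ip x y"
  using ip_add_left[of x "- x" y] by (simp add: add_eq_0_iff)

lemma ip_minus_right [simp]: "ip x (- y) = - ip x y"
  using ip_add_right[of x y "- y"] by (simp add: add_eq_0_iff)

lemma ip_diff_left: "ip (x - y) z = ip x z - ip y z"
  using ip_add_left[of x "- y" z] by simp

lemma ip_diff_right: "ip z (x - y) = ip z x - ip z y"
  using ip_add_right[of z x "- y"] by simp

lemma ip_sum_left: "ip (sum g F) x = (\<Sum>j\<in>F. ip (g j) x)"
  by (induction F rule: infinite_finite_induct) (auto simp: ip_add_left)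

lemma npos_ip: "npos (ip x x)"
  using ip_positive cstar_positive_iff_npos by blast

lemma ip_eqI: "(\<And>v. ip u v = ip w v) \<Longrightarrow> u = w"
  using ip_definite[of "u - w"] by (simp add: ip_diff_left)

abbreviation mnorm :: "'h \<Rightarrow> real" where
  "mnorm \<equiv> mod_norm ip"

lemma mnorm_power2: "mnorm x ^ 2 = norm (ip x x)"
  by (simp add: mod_norm_def)

lemma mnorm_ge_0 [simp]: "mnorm x \<ge> 0"
  by (simp add: mod_norm_def)

lemma mnorm_eq_0 [simp]: "mnorm x = 0 \<longleftrightarrow> x = 0"
  using ip_definite by (auto simp: mod_norm_def)

lemma mnorm_0 [simp]: "mnorm 0 = 0"
  by simp

lemma mnorm_minus [simp]: "mnorm (- x) = mnorm x"
  by (simp add: mod_norm_def)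

lemma mnorm_diff_commute: "mnorm (x - y) = mnorm (y - x)"
  using mnorm_minus[of "x - y"] by simp

lemma norm_ip_le: "norm (ip x y) \<le> mnorm x * mnorm y"
proof -
  have "npos (ip x x - a * star (ip x y) - ip x y * star a + a * ip y y * star a)" for a
    using npos_ip[of "x - smul a y"]
    by (simp add: ip_diff_left ip_diff_right ip_smul_left ip_smul_right ip_star algebra_simps)
  then have "norm (ip x y) ^ 2 \<le> (mnorm x * mnorm y) ^ 2"
    unfolding power_mult_distrib mnorm_power2 by (intro norm_Cauchy_Schwarz npos_ip)
  then show ?thesis
    by (rule power2_le_imp_le) simp
qed

lemma mnorm_triangle: "mnorm (x + y) \<le> mnorm x + mnorm y"
proof (rule power2_le_imp_le)
  have "mnorm (x + y) ^ 2 = norm (ip x x + ip x y + (ip y x + ip y y))"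
    by (simp add: mnorm_power2 ip_add_left ip_add_right algebra_simps)
  also have "\<dots> \<le> norm (ip x x) + norm (ip x y) + (norm (ip y x) + norm (ip y y))"
    by (intro norm_triangle_le add_mono order_refl)
  also have "\<dots> \<le> mnorm x ^ 2 + mnorm x * mnorm y + (mnorm y * mnorm x + mnorm y ^ 2)"
    unfolding mnorm_power2 by (intro add_mono norm_ip_le order_refl)
  finally show "mnorm (x + y) ^ 2 \<le> (mnorm x + mnorm y) ^ 2"
    by (simp add: power2_eq_square algebra_simps)
qed simp

lemma mnorm_triangle_diff: "mnorm (x - z) \<le> mnorm (x - y) + mnorm (y - z)"
  using mnorm_triangle[of "x - y" "y - z"] by simp

lemma mnorm_diff_triangle: "mnorm (x - y) \<le> mnorm x + mnorm y"
  using mnorm_triangle[of x "- y"] by simp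

text \<open>The type of module elements is only an additive group, so real scalars have to act
  through the algebra.\<close>

definition rscale :: "real \<Rightarrow> 'h \<Rightarrow> 'h" where
  "rscale r x = smul (of_real r) x"

lemma ip_rscale_left [simp]: "ip (rscale r x) y = r *\<^sub>R ip x y"
  by (simp add: rscale_def ip_smul_left scaleR_conv_of_real)

lemma ip_rscale_right [simp]: "ip x (rscale r y) = r *\<^sub>R ip x y"
  by (simp add: rscale_def ip_smul_right of_real_def)

lemma mnorm_rscale [simp]: "mnorm (rscale r x) = \<bar>r\<bar> * mnorm x"
proof -
  have "mnorm (rscale r x) = sqrt (r * r * norm (ip x x))"
    by (simp add: mod_norm_def abs_mult mult.assoc)
  then show ?thesis
    by (simp add: mod_norm_def real_sqrt_mult)
qed

lemma rscale_simps [simp]: "rscale 1 x = x" "rscale r (rscale s x) = rscale (r * s) x"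
  by (simp_all add: rscale_def smul_one smul_smul)

text \<open>The type of module elements carries no topology; limits are taken of real norms, or of
  inner products in the algebra.\<close>

definition mconv :: "(nat \<Rightarrow> 'h) \<Rightarrow> 'h \<Rightarrow> bool" where
  "mconv X l \<longleftrightarrow> (\<lambda>n. mnorm (X n - l)) \<longlonglongrightarrow> 0"

lemma mod_sums_iff_mconv: "mod_sums ip J f s \<longleftrightarrow> mconv (\<lambda>n. \<Sum>j\<in>J \<inter> {..<n}. f j) s"
  by (simp add: mod_sums_def mconv_def)

lemma mconv_bound:
  assumes "mconv X l" "\<And>n. mnorm (Y n - k) \<le> c * mnorm (X n - l)"
  shows "mconv Y k"
  unfolding mconv_def
proof (rule Lim_null_comparison)
  show "(\<lambda>n. c * mnorm (X n - l)) \<longlonglongrightarrow> 0"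
    using assms(1) tendsto_mult_right_zero unfolding mconv_def by blast
qed (use assms in auto)

lemma mconv_ip:
  assumes "mconv X l"
  shows "(\<lambda>n. ip (X n) v) \<longlonglongrightarrow> ip l v"
proof (rule LIM_zero_cancel, rule Lim_null_comparison)
  show "(\<lambda>n. mnorm (X n - l) * mnorm v) \<longlonglongrightarrow> 0"
    using assms tendsto_mult_left_zero unfolding mconv_def by blast
qed (use norm_ip_le in \<open>auto simp flip: ip_diff_left\<close>)

lemma mconv_unique: "mconv X l \<Longrightarrow> mconv X k \<Longrightarrow> l = k"
  by (rule ip_eqI) (metis mconv_ip LIMSEQ_unique)

lemma mconv_Suc: "mconv X l \<Longrightarrow> mconv (\<lambda>n. X (Suc n)) l"
  unfolding mconv_def by (rule LIMSEQ_Suc)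

lemma mconv_add:
  assumes "mconv X l" "mconv Y k"
  shows "mconv (\<lambda>n. X n + Y n) (l + k)"
  unfolding mconv_def
proof (rule Lim_null_comparison)
  show "(\<lambda>n. mnorm (X n - l) + mnorm (Y n - k)) \<longlonglongrightarrow> 0"
    using assms tendsto_add_zero unfolding mconv_def by blast
  have "mnorm (X n + Y n - (l + k)) \<le> mnorm (X n - l) + mnorm (Y n - k)" for n
    using mnorm_triangle[of "X n - l" "Y n - k"] by (simp add: algebra_simps)
  then show "\<forall>\<^sub>F n in sequentially. norm (mnorm (X n + Y n - (l + k)))
      \<le> mnorm (X n - l) + mnorm (Y n - k)"
    by simp
qed

lemma mconv_const: "mconv (\<lambda>n. l) l"
  by (simp add: mconv_def)

lemma mnorm_limit_le:
  assumes "mconv X l" "\<And>n. mnorm (X n) \<le> c"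
  shows "mnorm l \<le> c"
proof (rule LIMSEQ_le_const)
  show "(\<lambda>n. c + mnorm (X n - l)) \<longlonglongrightarrow> c"
    using assms(1) tendsto_add[OF tendsto_const[of c]] unfolding mconv_def by fastforce
  have "mnorm l \<le> c + mnorm (X n - l)" for n
    using mnorm_diff_triangle[of "X n" "X n - l"] assms(2)[of n] by simp
  then show "\<exists>N. \<forall>n\<ge>N. mnorm l \<le> c + mnorm (X n - l)"
    by blast
qed

text \<open>The replacement for the Banach fixed point theorem on the module: geometric steps make
  the sequence Cauchy, and completeness applies.\<close>

lemma mconv_geometric:
  assumes step: "\<And>n. mnorm (X (Suc n) - X n) \<le> c * \<rho> ^ n" and \<rho>: "0 \<le> \<rho>" "\<rho> < 1"
  shows "\<exists>l. mconv X l"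
  unfolding mconv_def
proof (rule mod_complete)
  fix e :: real assume e: "e > 0"
  have c: "c \<ge> 0"
    using order_trans[OF mnorm_ge_0 step[of 0]] by simp
  have tail: "mnorm (X (n + k) - X n) \<le> c * \<rho> ^ n * (1 - \<rho> ^ k) / (1 - \<rho>)" for n k
  proof (induction k)
    case (Suc k)
    have "mnorm (X (n + Suc k) - X n) \<le> c * \<rho> ^ (n + k) + c * \<rho> ^ n * (1 - \<rho> ^ k) / (1 - \<rho>)"
      using mnorm_triangle_diff[of "X (n + Suc k)" "X n" "X (n + k)"] step[of "n + k"] Suc by simp
    also have "\<dots> = c * \<rho> ^ n * (1 - \<rho> ^ Suc k) / (1 - \<rho>)"
      using \<rho> by (simp add: power_add field_simps)
    finally show ?case .
  qed simp
  have tail': "mnorm (X m - X n) \<le> c / (1 - \<rho>) * \<rho> ^ n" if "m \<ge> n" for m n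
  proof -
    have "c * \<rho> ^ n * (1 - \<rho> ^ (m - n)) / (1 - \<rho>) \<le> c * \<rho> ^ n * 1 / (1 - \<rho>)"
      using c \<rho> by (intro divide_right_mono mult_left_mono) auto
    then show ?thesis
      using tail[of n "m - n"] that by simp
  qed
  have "(\<lambda>n. c / (1 - \<rho>) * \<rho> ^ n) \<longlonglongrightarrow> 0"
    using LIMSEQ_realpow_zero[OF \<rho>] tendsto_mult_right_zero by blast
  then have "\<forall>\<^sub>F n in sequentially. c / (1 - \<rho>) * \<rho> ^ n < e"
    using e by (rule order_tendstoD(2))
  then obtain N where N: "\<And>n. n \<ge> N \<Longrightarrow> c / (1 - \<rho>) * \<rho> ^ n < e"
    unfolding eventually_sequentially by blast
  have "mnorm (X m - X n) < e" if "m \<ge> N" "n \<ge> N" for m n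
    using tail'[of n m] tail'[of m n] N[OF that(1)] N[OF that(2)] mnorm_diff_commute[of "X m" "X n"]
    by (cases "n \<le> m") auto
  then show "\<exists>N. \<forall>m\<ge>N. \<forall>n\<ge>N. mnorm (X m - X n) < e"
    by blast
qed

section \<open>Self-adjoint operators and their square roots\<close>

definition selfadjoint_op :: "('h \<Rightarrow> 'h) \<Rightarrow> bool" where
  "selfadjoint_op T \<longleftrightarrow> (\<forall>u v. ip (T u) v = ip u (T v))"

lemma selfadjoint_opD: "selfadjoint_op T \<Longrightarrow> ip (T u) v = ip u (T v)"
  by (simp add: selfadjoint_op_def)

text \<open>Having an adjoint already forces linearity, because vectors are separated by inner
  products. Hence \<open>selfadjoint_op\<close> makes no mention of it.\<close>

lemma adjoint_add:
  assumes "\<And>u v. ip (T u) v = ip u (T' v)"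
  shows "T (u + w) = T u + T w"
  by (rule ip_eqI) (simp add: assms ip_add_left)

lemma adjoint_smul:
  assumes "\<And>u v. ip (T u) v = ip u (T' v)"
  shows "T (smul a u) = smul a (T u)"
  by (rule ip_eqI) (simp add: assms ip_smul_left)

lemma selfadjoint_op_add: "selfadjoint_op T \<Longrightarrow> T (u + w) = T u + T w"
  using adjoint_add[of T T] by (simp add: selfadjoint_op_def)

lemma selfadjoint_op_diff: "selfadjoint_op T \<Longrightarrow> T (u - w) = T u - T w"
  using selfadjoint_op_add[of T "u - w" w] by simp

lemma selfadjoint_bounded_adjointable:
  assumes "selfadjoint_op T" "\<And>u. mnorm (T u) \<le> B * mnorm u"
  shows "bounded_adjointable smul ip T"
  using assms adjoint_add[of T T] adjoint_smul[of T T]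
  unfolding bounded_adjointable_def is_adjoint_def selfadjoint_op_def by auto

text \<open>Cauchy-Schwarz for the positive form \<open>\<langle>R u, v\<rangle>\<close>, taken at
  \<open>v = R u\<close>, bounds the fourth power of \<open>mnorm (R u)\<close> by
  \<open>r^2 (mnorm u)^2 (mnorm (R u))^2\<close>; a factor then cancels.\<close>

lemma mnorm_positive_op_le:
  assumes R: "selfadjoint_op R" and r: "r \<ge> 0"
    and pos: "\<And>u. npos (ip (R u) u)" and le: "\<And>u. npos (r *\<^sub>R ip u u - ip (R u) u)"
  shows "mnorm (R u) \<le> r * mnorm u"
proof -
  have bound: "norm (ip (R v) v) \<le> r * mnorm v ^ 2" for v
    using npos_norm_mono[OF pos le, of v] r by (simp add: mnorm_power2)
  have "npos (ip (R u) u - a * star (ip (R u) v) - ip (R u) v * star a + a * ip (R v) v * star a)"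
    for a v
  proof -
    have eq: "R (u - smul a v) = R u - smul a (R v)"
      using selfadjoint_op_diff[OF R] adjoint_smul[of R R] R by (simp add: selfadjoint_op_def)
    then show ?thesis
      using pos[of "u - smul a v"] selfadjoint_opD[OF R, of v u] unfolding eq
      by (simp add: ip_diff_left ip_diff_right ip_smul_left ip_smul_right ip_star algebra_simps)
  qed
  then have "norm (ip (R u) (R u)) ^ 2 \<le> norm (ip (R u) u) * norm (ip (R (R u)) (R u))"
    by (intro norm_Cauchy_Schwarz pos)
  also have "\<dots> \<le> (r * mnorm u ^ 2) * (r * mnorm (R u) ^ 2)"
    using r by (intro mult_mono bound) auto
  finally have le4: "mnorm (R u) ^ 2 * mnorm (R u) ^ 2 \<le> (r * mnorm u) ^ 2 * mnorm (R u) ^ 2"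
    by (simp add: mnorm_power2 [symmetric] power2_eq_square mult_ac)
  have "mnorm (R u) ^ 2 \<le> (r * mnorm u) ^ 2"
  proof (cases "R u = 0")
    case False
    then have "mnorm (R u) ^ 2 > 0"
      by simp
    with le4 show ?thesis
      by (simp only: mult_le_cancel_right_pos)
  qed simp
  then show ?thesis
    by (rule power2_le_imp_le) (use r in simp)
qed

text \<open>The iteration runs on the values at each vector, so its limit can be taken pointwise in
  the module and no Banach space of operators is required.\<close>

primrec sqrt_iter :: "('h \<Rightarrow> 'h) \<Rightarrow> nat \<Rightarrow> 'h \<Rightarrow> 'h" where
  "sqrt_iter R 0 u = 0"
| "sqrt_iter R (Suc n) u = rscale (1 / 2) (R u + sqrt_iter R n (sqrt_iter R n u))"

text \<open>If \<open>Y = (R + Y\<^sup>2) / 2\<close>, then \<open>(1 - Y)\<^sup>2 = 1 - R\<close>; for \<open>\<parallel>R\<parallel> \<le> r < 1\<close> the fixed point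
  iteration is a contraction on the ball of radius \<open>1 - sqrt (1 - r)\<close>.\<close>

lemma sqrt_one_minus_op:
  assumes R: "selfadjoint_op R" "\<And>u. mnorm (R u) \<le> r * mnorm u" and r: "0 \<le> r" "r < 1"
  obtains Q \<rho> where "selfadjoint_op Q" "\<And>u. Q (Q u) = u - R u" "0 \<le> \<rho>" "\<rho> < 1"
    "\<And>u. mnorm (u - Q u) \<le> \<rho> * mnorm u"
proof -
  define \<rho> where "\<rho> = 1 - sqrt (1 - r)"
  have \<rho>: "0 \<le> \<rho>" "\<rho> < 1" "(r + \<rho> * \<rho>) / 2 = \<rho>"
    using r by (auto simp: \<rho>_def field_simps)
  define Y where "Y = sqrt_iter R"
  have Y_0: "Y 0 u = 0" and Y_Suc: "Y (Suc n) u = rscale (1 / 2) (R u + Y n (Y n u))" for n u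
    by (simp_all add: Y_def)
  have saY: "selfadjoint_op (Y n)" for n
  proof (induction n)
    case (Suc n)
    then show ?case
      using R(1) by (simp add: selfadjoint_op_def Y_Suc ip_add_left ip_add_right)
  qed (simp add: selfadjoint_op_def Y_0)
  have bound: "mnorm (Y n u) \<le> \<rho> * mnorm u" for n u
  proof (induction n arbitrary: u)
    case (Suc n)
    have "mnorm (Y n (Y n u)) \<le> \<rho> * (\<rho> * mnorm u)"
      using Suc[of "Y n u"] mult_left_mono[OF Suc[of u] \<rho>(1)] by linarith
    then have "mnorm (Y (Suc n) u) \<le> (r * mnorm u + \<rho> * (\<rho> * mnorm u)) / 2"
      using mnorm_triangle[of "R u" "Y n (Y n u)"] R(2)[of u] by (simp add: Y_Suc)
    also have "\<dots> = (r + \<rho> * \<rho>) / 2 * mnorm u"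
      by (simp add: algebra_simps)
    finally show ?case
      using \<rho> by simp
  qed (use \<rho> in \<open>simp add: Y_0\<close>)
  have step: "mnorm (Y (Suc n) u - Y n u) \<le> mnorm u * \<rho> ^ n" for n u
  proof (induction n arbitrary: u)
    case 0
    show ?case
      using bound[of "Suc 0" u] mult_right_mono[of \<rho> 1 "mnorm u"] \<rho> by (simp add: Y_0)
  next
    case (Suc n)
    define d where "d v = Y (Suc n) v - Y n v" for v
    have d: "mnorm (d v) \<le> mnorm v * \<rho> ^ n" for v
      unfolding d_def by (rule Suc)
    \<comment> \<open>The difference of the squares of two operators \<open>Y\<close> and
      \<open>Y'\<close>, split as \<open>Y (Y - Y') + (Y - Y') Y'\<close> so that they need not
      commute.\<close>
    have "Y (Suc (Suc n)) u - Y (Suc n) u = rscale (1 / 2) (Y (Suc n) (d u) + d (Y n u))"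
      by (rule ip_eqI) (simp add: Y_Suc[of "Suc n"] Y_Suc[of n u] d_def selfadjoint_op_diff[OF saY]
          ip_diff_left ip_add_left algebra_simps)
    then have "mnorm (Y (Suc (Suc n)) u - Y (Suc n) u)
        \<le> (mnorm (Y (Suc n) (d u)) + mnorm (d (Y n u))) / 2"
      using mnorm_triangle[of "Y (Suc n) (d u)" "d (Y n u)"] by simp
    also have "\<dots> \<le> (\<rho> * (mnorm u * \<rho> ^ n) + (\<rho> * mnorm u) * \<rho> ^ n) / 2"
    proof (intro divide_right_mono add_mono)
      show "mnorm (Y (Suc n) (d u)) \<le> \<rho> * (mnorm u * \<rho> ^ n)"
        using bound[of "Suc n" "d u"] mult_left_mono[OF d[of u] \<rho>(1)] by linarith
      have "mnorm (Y n u) * \<rho> ^ n \<le> \<rho> * mnorm u * \<rho> ^ n"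
        using \<rho>(1) bound by (intro mult_right_mono) auto
      then show "mnorm (d (Y n u)) \<le> \<rho> * mnorm u * \<rho> ^ n"
        using d[of "Y n u"] by linarith
    qed simp
    finally show ?case
      by (simp add: mult_ac)
  qed
  have "\<exists>l. mconv (\<lambda>n. Y n u) l" for u
    using step \<rho> by (intro mconv_geometric)
  then obtain Z where Z: "\<And>u. mconv (\<lambda>n. Y n u) (Z u)"
    by metis
  have Zb: "mnorm (Z u) \<le> \<rho> * mnorm u" for u
    using Z bound by (rule mnorm_limit_le)
  have saZ: "selfadjoint_op Z"
    unfolding selfadjoint_op_def
  proof (intro allI)
    fix u v
    have "(\<lambda>n. ip (Y n u) v) \<longlonglongrightarrow> ip (Z u) v" "(\<lambda>n. star (ip (Y n v) u)) \<longlonglongrightarrow> star (ip (Z v) u)"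
      by (intro mconv_ip Z bounded_linear.tendsto[OF bounded_linear_star])+
    moreover have "star (ip (Y n v) u) = ip (Y n u) v" for n
      using saY[of n] by (simp add: ip_star selfadjoint_op_def)
    ultimately show "ip (Z u) v = ip u (Z v)"
      using LIMSEQ_unique by (fastforce simp: ip_star)
  qed
  have fix_Z: "Z u = rscale (1 / 2) (R u + Z (Z u))" for u
  proof (rule mconv_unique)
    show "mconv (\<lambda>n. Y (Suc n) u) (Z u)"
      by (intro mconv_Suc Z)
    \<comment> \<open>In \<open>Y n (Y n u)\<close> both the operator and its argument vary. The
      uniform bound on \<open>Y n\<close> absorbs the change of argument, leaving the pointwise
      limit at the fixed vector \<open>Z u\<close>.\<close>
    have "mconv (\<lambda>n. Y n (Y n u - Z u)) 0"
      using Z[of u] by (rule mconv_bound[where c = \<rho>]) (use bound in simp)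
    then have "mconv (\<lambda>n. R u + (Y n (Y n u - Z u) + Y n (Z u))) (R u + (0 + Z (Z u)))"
      by (intro mconv_add mconv_const Z)
    then show "mconv (\<lambda>n. Y (Suc n) u) (rscale (1 / 2) (R u + Z (Z u)))"
    proof (rule mconv_bound[where c = "1/2"])
      fix n
      have "Y (Suc n) u - rscale (1 / 2) (R u + Z (Z u))
        = rscale (1 / 2) (R u + (Y n (Y n u - Z u) + Y n (Z u)) - (R u + (0 + Z (Z u))))"
        by (rule ip_eqI) (simp add: Y_Suc selfadjoint_op_diff[OF saY] ip_diff_left ip_add_left
            algebra_simps)
      then show "mnorm (Y (Suc n) u - rscale (1 / 2) (R u + Z (Z u)))
        \<le> 1 / 2 * mnorm (R u + (Y n (Y n u - Z u) + Y n (Z u)) - (R u + (0 + Z (Z u))))"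
        by simp
    qed
  qed
  show ?thesis
  proof (rule that[of "\<lambda>u. u - Z u" \<rho>])
    show "selfadjoint_op (\<lambda>u. u - Z u)"
      using saZ by (simp add: selfadjoint_op_def ip_diff_left ip_diff_right)
    show "u - Z u - Z (u - Z u) = u - R u" for u
    proof (rule ip_eqI)
      fix v
      have "2 *\<^sub>R ip (Z u) v = ip (R u) v + ip (Z (Z u)) v"
        using arg_cong[OF fix_Z[of u], of "\<lambda>z. 2 *\<^sub>R ip z v"] by (simp add: ip_add_left)
      then show "ip (u - Z u - Z (u - Z u)) v = ip (u - R u) v"
        by (simp add: selfadjoint_op_diff[OF saZ] ip_diff_left ip_add_left scaleR_2 algebra_simps)
    qed
  qed (use \<rho> Zb in auto)
qed

lemma bij_near_identity:
  assumes Q: "selfadjoint_op Q" "\<And>u. mnorm (u - Q u) \<le> \<rho> * mnorm u" and \<rho>: "0 \<le> \<rho>" "\<rho> < 1"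
  shows "bij Q"
proof (rule bijI)
  show "inj Q"
  proof (rule injI)
    fix u w assume "Q u = Q w"
    then have "Q (u - w) = 0"
      by (simp add: selfadjoint_op_diff[OF Q(1)])
    then have "mnorm (u - w) * (1 - \<rho>) \<le> 0"
      using Q(2)[of "u - w"] by (simp add: algebra_simps)
    then have "mnorm (u - w) = 0"
      using \<rho> mnorm_ge_0[of "u - w"] by (simp add: mult_le_0_iff)
    then show "u = w"
      by simp
  qed
  show "surj Q"
  proof (rule surjI[where f = "\<lambda>v. SOME u. Q u = v"], rule someI_ex)
    fix v
    \<comment> \<open>The iterates of \<open>u \<mapsto> v + (u - Q u)\<close>, whose fixed points
      are the preimages of \<open>v\<close>.\<close>
    define X where "X = rec_nat 0 (\<lambda>_ u. v + (u - Q u))"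
    have X: "X 0 = 0" "X (Suc n) = v + (X n - Q (X n))" for n
      by (simp_all add: X_def)
    have Q0: "Q 0 = 0"
      using selfadjoint_op_diff[OF Q(1), of 0 0] by simp
    have "mnorm (X (Suc n) - X n) \<le> mnorm v * \<rho> ^ n" for n
    proof (induction n)
      case (Suc n)
      have "X (Suc (Suc n)) - X (Suc n) = (X (Suc n) - X n) - Q (X (Suc n) - X n)"
        by (simp add: X(2)[of "Suc n"] X(2)[of n] selfadjoint_op_diff[OF Q(1)]
            selfadjoint_op_add[OF Q(1)])
      then have "mnorm (X (Suc (Suc n)) - X (Suc n)) \<le> \<rho> * mnorm (X (Suc n) - X n)"
        by (metis Q(2))
      also have "\<dots> \<le> \<rho> * (mnorm v * \<rho> ^ n)"
        using Suc \<rho> by (intro mult_left_mono)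
      finally show ?case
        by (simp add: mult_ac)
    qed (simp add: X Q0)
    then obtain l where l: "mconv X l"
      using mconv_geometric \<rho> by blast
    have "mconv (\<lambda>n. X n - Q (X n)) (l - Q l)"
      using l
    proof (rule mconv_bound[where c = \<rho>])
      fix n
      have "X n - Q (X n) - (l - Q l) = (X n - l) - Q (X n - l)"
        by (simp add: selfadjoint_op_diff[OF Q(1)])
      then show "mnorm (X n - Q (X n) - (l - Q l)) \<le> \<rho> * mnorm (X n - l)"
        by (metis Q(2))
    qed
    then have "mconv (\<lambda>n. X (Suc n)) (v + (l - Q l))"
      unfolding X by (intro mconv_add mconv_const)
    then have "v + (l - Q l) = l"
      using mconv_Suc[OF l] by (rule mconv_unique)
    then show "\<exists>u. Q u = v"
      by (metis add_diff_cancel_left' add_diff_eq add.commute diff_add_cancel)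
  qed
qed

text \<open>\<open>T\<close> is the inverse square root of \<open>G\<close>. The first two
  identities say that its square inverts \<open>G\<close>; the third is what makes a frame
  transformed by \<open>T\<close> tight.\<close>

lemma positive_op_inverse_sqrt:
  assumes G: "selfadjoint_op G" and C: "C > 0"
    and lower: "\<And>u. npos (ip (G u) u - C *\<^sub>R ip u u)"
    and upper: "\<And>u. npos (D *\<^sub>R ip u u - ip (G u) u)"
  obtains T where "invertible_adjointable smul ip T" "selfadjoint_op T"
    "\<And>u. T (T (G u)) = u" "\<And>u. G (T (T u)) = u" "\<And>u. T (G (T u)) = u"
proof -
  \<comment> \<open>On the zero module \<open>D\<close> may lie below \<open>C\<close>. The maximum
    ensures \<open>E > 0\<close> and \<open>r \<ge> 0\<close>.\<close>
  define E where "E = max C D"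
  have E: "E > 0" "C \<le> E"
    using C by (auto simp: E_def)
  define r where "r = 1 - C / E"
  have r: "0 \<le> r" "r < 1"
    using C E by (auto simp: r_def)
  define R where "R u = u - rscale (1 / E) (G u)" for u
  have R: "selfadjoint_op R"
    using G by (simp add: selfadjoint_op_def R_def ip_diff_left ip_diff_right)
  have "npos (ip (R u) u)" for u
  proof -
    have "npos ((D *\<^sub>R ip u u - ip (G u) u) + (E - D) *\<^sub>R ip u u)"
      by (intro npos_add upper npos_scaleR npos_ip) (simp add: E_def)
    then have "npos ((1 / E) *\<^sub>R (E *\<^sub>R ip u u - ip (G u) u))"
      using E by (intro npos_scaleR) (simp_all add: algebra_simps)
    then show ?thesis
      using E by (simp add: R_def ip_diff_left scaleR_diff_right)
  qed
  moreover have "npos (r *\<^sub>R ip u u - ip (R u) u)" for u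
  proof -
    have "npos ((1 / E) *\<^sub>R (ip (G u) u - C *\<^sub>R ip u u))"
      using E lower by (intro npos_scaleR) auto
    then show ?thesis
      by (simp add: r_def R_def ip_diff_left algebra_simps)
  qed
  ultimately have "mnorm (R u) \<le> r * mnorm u" for u
    using R r by (intro mnorm_positive_op_le)
  then obtain Q \<rho> where Q: "selfadjoint_op Q" "\<And>u. Q (Q u) = u - R u" "0 \<le> \<rho>" "\<rho> < 1"
    "\<And>u. mnorm (u - Q u) \<le> \<rho> * mnorm u"
    using sqrt_one_minus_op[OF R] r by metis
  have bij: "bij Q"
    using bij_near_identity Q by blast
  define P where "P = inv Q"
  have PQ: "P (Q u) = u" "Q (P u) = u" for u
    using bij by (simp_all add: P_def bij_is_inj bij_is_surj surj_f_inv_f)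
  have QQ: "Q (Q u) = rscale (1 / E) (G u)" for u
    by (simp add: Q R_def)
  have Q_rscale: "Q (rscale a u) = rscale a (Q u)" for a u
    using adjoint_smul[of Q Q] Q(1) by (simp add: rscale_def selfadjoint_op_def)
  have saP: "selfadjoint_op P"
    unfolding selfadjoint_op_def by (metis PQ(2) selfadjoint_opD[OF Q(1)])
  have P_rscale: "P (rscale a u) = rscale a (P u)" for a u
    using adjoint_smul[of P P] saP by (simp add: rscale_def selfadjoint_op_def)
  have G_rscale: "G (rscale a u) = rscale a (G u)" for a u
    using adjoint_smul[of G G] G by (simp add: rscale_def selfadjoint_op_def)
  have GQ: "G u = rscale E (Q (Q u))" for u
    using E by (simp add: QQ)
  \<comment> \<open>Since \<open>G = E Q^2\<close>, the inverse square root of \<open>G\<close> is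
    the inverse of \<open>Q\<close> divided by the root of \<open>E\<close>.\<close>
  define T where "T u = rscale (1 / sqrt E) (P u)" for u
  define T' where "T' u = rscale (sqrt E) (Q u)" for u
  have saT: "selfadjoint_op T" and saT': "selfadjoint_op T'"
    using saP Q(1) by (simp_all add: selfadjoint_op_def T_def T'_def)
  have bQ: "mnorm (Q u) \<le> 2 * mnorm u" for u
  proof -
    have "mnorm (Q u) \<le> mnorm u + mnorm (u - Q u)"
      using mnorm_diff_triangle[of u "u - Q u"] by simp
    also have "mnorm (u - Q u) \<le> 1 * mnorm u"
      using Q(5)[of u] mult_right_mono[of \<rho> 1 "mnorm u"] Q(4) by simp
    finally show ?thesis
      by simp
  qed
  have bP: "mnorm (P u) \<le> 1 / (1 - \<rho>) * mnorm u" for u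
  proof -
    have "mnorm (P u) \<le> mnorm (Q (P u)) + mnorm (P u - Q (P u))"
      using mnorm_triangle[of "Q (P u)" "P u - Q (P u)"] by simp
    then have "mnorm (P u) \<le> mnorm u + \<rho> * mnorm (P u)"
      using Q(5)[of "P u"] by (simp add: PQ)
    then show ?thesis
      using Q(4) by (simp add: field_simps)
  qed
  have "bounded_adjointable smul ip T"
  proof (rule selfadjoint_bounded_adjointable[OF saT])
    show "mnorm (T u) \<le> 1 / sqrt E * (1 / (1 - \<rho>)) * mnorm u" for u
      using mult_left_mono[OF bP[of u], of "1 / sqrt E"] E by (simp add: T_def)
  qed
  moreover have "bounded_adjointable smul ip T'"
  proof (rule selfadjoint_bounded_adjointable[OF saT'])
    show "mnorm (T' u) \<le> sqrt E * 2 * mnorm u" for u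
      using mult_left_mono[OF bQ[of u], of "sqrt E"] E by (simp add: T'_def)
  qed
  moreover have "T' \<circ> T = id" "T \<circ> T' = id"
    using E by (auto simp: T_def T'_def fun_eq_iff Q_rscale P_rscale PQ)
  ultimately have "invertible_adjointable smul ip T"
    unfolding invertible_adjointable_def by blast
  moreover have "T (T (G u)) = u" "G (T (T u)) = u" "T (G (T u)) = u" for u
    using E by (simp_all add: T_def GQ Q_rscale P_rscale PQ)
  ultimately show ?thesis
    using that saT by blast
qed

end

section \<open>Frames\<close>

lemma sums_tight_iff:
  "standard_tight_frame ip J f \<longleftrightarrow>
    (\<forall>u. (\<lambda>j. if j \<in> J then ip u (f j) * ip (f j) u else 0) sums ip u u)"
proof -
  have "cstar_le a b \<and> cstar_le b a \<longleftrightarrow> b = a" for a b :: 'b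
    using npos_antisym[of "b - a"] by (auto simp: cstar_le_iff_npos)
  then show ?thesis
    unfolding standard_tight_frame_def standard_frame_bounds_def sums_iff by simp
qed

text \<open>Testing against \<open>w\<close> moves the condition into the algebra, where applying
  the involution exchanges the two frames. Norm convergence of the scalar series is part of the
  condition.\<close>

definition gram_zero ::
  "('h \<Rightarrow> 'h \<Rightarrow> 'a::cstar_algebra) \<Rightarrow> ('k \<Rightarrow> 'k \<Rightarrow> 'a)
    \<Rightarrow> nat set \<Rightarrow> (nat \<Rightarrow> 'h) \<Rightarrow> (nat \<Rightarrow> 'k) \<Rightarrow> bool" where
  "gram_zero ipH ipK J f g \<longleftrightarrow>
    (\<forall>u w. (\<lambda>j. if j \<in> J then ipH u (f j) * ipK (g j) w else 0) sums 0)"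

section \<open>Synthesis series, frame operators and canonical duals\<close>

context hilbert_module
begin

definition bessel :: "nat set \<Rightarrow> (nat \<Rightarrow> 'h) \<Rightarrow> real \<Rightarrow> bool" where
  "bessel J f D \<longleftrightarrow> D \<ge> 0 \<and> (\<forall>u. summable (\<lambda>j. if j \<in> J then ip u (f j) * ip (f j) u else 0) \<and>
    npos (D *\<^sub>R ip u u - (\<Sum>j. if j \<in> J then ip u (f j) * ip (f j) u else 0)))"

lemma standard_frame_bessel:
  assumes "standard_frame ip J f"
  obtains D where "bessel J f D"
proof -
  obtain C D where "D > 0" "standard_frame_bounds ip J f C D"
    using assms unfolding standard_frame_def by blast
  then have "bessel J f D"
    unfolding bessel_def standard_frame_bounds_def cstar_le_iff_npos by simp
  then show ?thesis
    by (rule that)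
qed

lemma npos_ip_mult: "npos (ip u v * ip v u)"
  using npos_mult_star_self[of "ip u v"] by (simp add: ip_star)

text \<open>Duality: for the sum \<open>z\<close>, \<open>\<langle>z,z\<rangle>\<close> is the sum
  of \<open>a j * \<langle>f j, z\<rangle>\<close>. Cauchy-Schwarz and the upper frame bound at
  \<open>z\<close> itself bound the fourth power of \<open>mnorm z\<close> by a multiple of its
  square, which cancels.\<close>

lemma bessel_sum_le:
  assumes f: "bessel J f D" and F: "finite F" "F \<subseteq> J"
  shows "mnorm (\<Sum>j\<in>F. smul (a j) (f j)) ^ 2 \<le> D * norm (\<Sum>j\<in>F. a j * star (a j))"
proof -
  define z where "z = (\<Sum>j\<in>F. smul (a j) (f j))"
  define A where "A = norm (\<Sum>j\<in>F. a j * star (a j))"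
  let ?g = "\<lambda>j. if j \<in> J then ip z (f j) * ip (f j) z else 0"
  have D: "D \<ge> 0" and g: "summable ?g" "npos (D *\<^sub>R ip z z - suminf ?g)"
    using f by (auto simp: bessel_def)
  have "npos (suminf ?g - sum ?g F)"
    using g F by (intro npos_suminf_minus_sum) (auto simp: npos_ip_mult)
  with g(2) have "npos (D *\<^sub>R ip z z - sum ?g F)"
    using npos_add by fastforce
  moreover have "npos (sum ?g F)"
    by (auto intro!: npos_sum simp: npos_ip_mult)
  ultimately have "norm (sum ?g F) \<le> D * mnorm z ^ 2"
    using npos_norm_mono D by (fastforce simp: mnorm_power2)
  also have "sum ?g F = (\<Sum>j\<in>F. ip z (f j) * star (ip z (f j)))"
    using F by (intro sum.cong) (auto simp: ip_star)
  finally have q: "norm (\<Sum>j\<in>F. ip z (f j) * star (ip z (f j))) \<le> D * mnorm z ^ 2" .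
  have "ip z z = (\<Sum>j\<in>F. a j * ip (f j) z)"
    by (subst (1) z_def) (simp add: ip_sum_left ip_smul_left)
  then have "ip z z = (\<Sum>j\<in>F. a j * star (ip z (f j)))"
    by (simp add: ip_star)
  then have "norm (ip z z) ^ 2 \<le> A * norm (\<Sum>j\<in>F. ip z (f j) * star (ip z (f j)))"
    unfolding A_def by (simp only: norm_sum_Cauchy_Schwarz)
  also have "\<dots> \<le> A * (D * mnorm z ^ 2)"
    using q by (intro mult_left_mono) (auto simp: A_def)
  finally have le4: "mnorm z ^ 2 * mnorm z ^ 2 \<le> D * A * mnorm z ^ 2"
    by (simp add: mnorm_power2[symmetric] power2_eq_square mult_ac)
  have "mnorm z ^ 2 \<le> D * A"
  proof (cases "z = 0")
    case False
    then have "mnorm z ^ 2 > 0"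
      by simp
    with le4 show ?thesis
      by (simp only: mult_le_cancel_right_pos)
  qed (use D in \<open>simp add: A_def\<close>)
  then show ?thesis
    by (simp add: z_def A_def)
qed

lemma bessel_mod_sums:
  assumes f: "bessel J f D" and a: "summable (\<lambda>j. if j \<in> J then a j * star (a j) else 0)"
  shows "\<exists>s. mod_sums ip J (\<lambda>j. smul (a j) (f j)) s"
  unfolding mod_sums_def
proof (rule mod_complete)
  fix e :: real assume e: "e > 0"
  have D: "D \<ge> 0"
    using f by (simp add: bessel_def)
  \<comment> \<open>The denominator \<open>D + 1\<close> covers \<open>D = 0\<close> and makes the
    final estimate strict.\<close>
  define \<delta> where "\<delta> = e ^ 2 / (D + 1)"
  have "\<delta> > 0"
    using e D by (simp add: \<delta>_def)
  then obtain N where N: "\<And>m n. m \<ge> N \<Longrightarrow>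
      norm (\<Sum>j\<in>{m..<n}. if j \<in> J then a j * star (a j) else 0) < \<delta>"
    using a unfolding summable_Cauchy by blast
  let ?X = "\<lambda>n. \<Sum>j\<in>J \<inter> {..<n}. smul (a j) (f j)"
  have less: "mnorm (?X n - ?X m) < e" if "N \<le> m" "m \<le> n" for m n
  proof -
    have "J \<inter> {..<n} - J \<inter> {..<m} = J \<inter> {m..<n}" "J \<inter> {..<m} \<subseteq> J \<inter> {..<n}"
      using that by auto
    then have "?X n - ?X m = (\<Sum>j\<in>J \<inter> {m..<n}. smul (a j) (f j))"
      using sum_diff[of "J \<inter> {..<n}" "J \<inter> {..<m}" "\<lambda>j. smul (a j) (f j)"] by simp
    then have "mnorm (?X n - ?X m) ^ 2 \<le> D * norm (\<Sum>j\<in>J \<inter> {m..<n}. a j * star (a j))"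
      using bessel_sum_le[OF f, of "J \<inter> {m..<n}" a] by simp
    also have "(\<Sum>j\<in>J \<inter> {m..<n}. a j * star (a j))
        = (\<Sum>j\<in>{m..<n}. if j \<in> J then a j * star (a j) else 0)"
      by (simp add: sum.inter_restrict Int_commute[of J])
    also have "D * norm \<dots> \<le> D * \<delta>"
      using N[OF that(1), of n] D by (intro mult_left_mono) auto
    also have "D * \<delta> < (D + 1) * \<delta>"
      using \<open>\<delta> > 0\<close> by simp
    also have "\<dots> = e ^ 2"
      using D by (simp add: \<delta>_def)
    finally show ?thesis
      using e by (intro power2_less_imp_less[of _ e]) auto
  qed
  have "mnorm (?X m - ?X n) < e" if "N \<le> m" "N \<le> n" for m n
    using less[of m n] less[of n m] that mnorm_diff_commute[of "?X m" "?X n"]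
    by (cases "m \<le> n") auto
  then show "\<exists>N. \<forall>m\<ge>N. \<forall>n\<ge>N. mnorm (?X m - ?X n) < e"
    by blast
qed

lemma mod_sums_ip:
  assumes "mod_sums ip J (\<lambda>j. smul (a j) (f j)) s"
  shows "(\<lambda>j. if j \<in> J then a j * ip (f j) v else 0) sums ip s v"
proof -
  have "ip (\<Sum>j\<in>J \<inter> {..<n}. smul (a j) (f j)) v = (\<Sum>j<n. if j \<in> J then a j * ip (f j) v else 0)"
    for n
    by (simp add: ip_sum_left ip_smul_left) (simp add: sum.inter_restrict Int_commute[of J])
  then show ?thesis
    using mconv_ip[OF assms[unfolded mod_sums_iff_mconv], of v] by (simp add: sums_def)
qed

lemma bessel_frame_transform_in_l2:
  assumes "bessel J f D"
  shows "frame_transform ip J f u \<in> l2"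
proof -
  have "(\<lambda>j. frame_transform ip J f u j * star (frame_transform ip J f u j))
      = (\<lambda>j. if j \<in> J then ip u (f j) * ip (f j) u else 0)"
    by (auto simp: frame_transform_def ip_star)
  then show ?thesis
    using assms by (simp add: l2_def bessel_def)
qed

text \<open>The adjoint is a choice, so its value must be identified: the synthesis series defines
  one adjoint, and any two agree on \<open>l2\<close> because inner products separate
  vectors.\<close>

lemma frame_transform_adj_mod_sums:
  assumes f: "bessel J f D" and a: "a \<in> l2"
  shows "mod_sums ip J (\<lambda>j. smul (a j) (f j)) (frame_transform_adj ip J f a)"
proof -
  define T where "T a = (SOME s. mod_sums ip J (\<lambda>j. smul (a j) (f j)) s)" for a
  have T: "mod_sums ip J (\<lambda>j. smul (a j) (f j)) (T a)" if "a \<in> l2" for a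
    unfolding T_def using that
    by (intro someI_ex[OF bessel_mod_sums[OF f]] summable_subseries npos_mult_star_self)
      (simp add: l2_def)
  have T_ip: "l2_ip (frame_transform ip J f u) a = ip u (T a)" if "a \<in> l2" for a u
  proof -
    have "(\<lambda>j. star (if j \<in> J then a j * ip (f j) u else 0)) sums star (ip (T a) u)"
      by (intro star_sums mod_sums_ip T that)
    also have "(\<lambda>j. star (if j \<in> J then a j * ip (f j) u else 0))
        = (\<lambda>j. frame_transform ip J f u j * star (a j))"
      by (auto simp: frame_transform_def star_mult ip_star)
    finally show ?thesis
      by (simp add: l2_ip_def ip_star sums_iff)
  qed
  have "is_adjoint UNIV ip l2 l2_ip (frame_transform ip J f) T"
    using bessel_frame_transform_in_l2[OF f] T_ip by (auto simp: is_adjoint_def)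
  then have "is_adjoint UNIV ip l2 l2_ip (frame_transform ip J f) (frame_transform_adj ip J f)"
    unfolding frame_transform_adj_def by (rule someI[of _ T])
  then have "ip u (frame_transform_adj ip J f a) = ip u (T a)" for u
    using T_ip a by (simp add: is_adjoint_def)
  then have "frame_transform_adj ip J f a = T a"
    by (intro ip_eqI) (metis ip_star)
  then show ?thesis
    using T a by simp
qed

lemma adj_transform_sums:
  assumes "standard_frame ip J f"
  shows "(\<lambda>j. if j \<in> J then ip u (f j) * ip (f j) v else 0)
    sums ip (frame_transform_adj ip J f (frame_transform ip J f u)) v"
proof -
  obtain D where D: "bessel J f D"
    using assms standard_frame_bessel by blast
  have "(\<lambda>j. if j \<in> J then frame_transform ip J f u j * ip (f j) v else 0)
      sums ip (frame_transform_adj ip J f (frame_transform ip J f u)) v"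
    by (intro mod_sums_ip frame_transform_adj_mod_sums[OF D] bessel_frame_transform_in_l2[OF D])
  then show ?thesis
    by (simp add: frame_transform_def cong: if_cong)
qed

text \<open>\<open>T\<close> is the square root of the frame operator. As \<open>T\<close> is
  self-adjoint, the displayed series is the tightness identity for the frame with members
  \<open>T (f j)\<close>.\<close>

lemma standard_frame_inverse_sqrt:
  assumes f: "standard_frame ip J f"
  obtains T where "invertible_adjointable smul ip T" "selfadjoint_op T"
    "\<And>u. frame_operator ip J f u = T (T u)"
    "\<And>u. (\<lambda>j. if j \<in> J then ip (T u) (f j) * ip (f j) (T u) else 0) sums ip u u"
    "\<And>u. frame_operator ip J f (frame_transform_adj ip J f (frame_transform ip J f u)) = u"
    "\<And>u. frame_transform_adj ip J f (frame_transform ip J f (frame_operator ip J f u)) = u"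
proof -
  define G where "G u = frame_transform_adj ip J f (frame_transform ip J f u)" for u
  have G: "(\<lambda>j. if j \<in> J then ip u (f j) * ip (f j) v else 0) sums ip (G u) v" for u v
    unfolding G_def by (rule adj_transform_sums[OF f])
  have "ip (G u) v = ip u (G v)" for u v
  proof -
    have "(\<lambda>j. star (if j \<in> J then ip v (f j) * ip (f j) u else 0)) sums star (ip (G v) u)"
      by (rule star_sums[OF G])
    also have "(\<lambda>j. star (if j \<in> J then ip v (f j) * ip (f j) u else 0))
        = (\<lambda>j. if j \<in> J then ip u (f j) * ip (f j) v else 0)"
      by (auto simp: star_mult ip_star)
    finally show ?thesis
      using sums_unique2[OF G] by (simp add: ip_star)
  qed
  then have saG: "selfadjoint_op G"
    by (simp add: selfadjoint_op_def)
  obtain C D where CD: "C > 0" "\<And>u. npos (ip (G u) u - C *\<^sub>R ip u u)"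
    "\<And>u. npos (D *\<^sub>R ip u u - ip (G u) u)"
    using f unfolding standard_frame_def standard_frame_bounds_def cstar_le_iff_npos
      sums_unique[OF G, symmetric] by blast
  obtain T where T: "invertible_adjointable smul ip T" "selfadjoint_op T"
    "\<And>u. T (T (G u)) = u" "\<And>u. G (T (T u)) = u" "\<And>u. T (G (T u)) = u"
    by (rule positive_op_inverse_sqrt[OF saG CD]) blast
  have "frame_operator ip J f = (\<lambda>u. T (T u))"
    unfolding frame_operator_def by (rule inv_equality) (simp_all add: T(3,4) flip: G_def)
  then have S: "frame_operator ip J f u = T (T u)" for u
    by simp
  have "ip (G (T u)) (T u) = ip u u" for u
    using selfadjoint_opD[OF T(2), of "G (T u)" u] by (simp add: T(5))
  then have "(\<lambda>j. if j \<in> J then ip (T u) (f j) * ip (f j) (T u) else 0) sums ip u u" for u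
    using G[of "T u" "T u"] by simp
  then show ?thesis
    by (rule that[OF T(1,2) S]) (simp_all add: S T(3,4) flip: G_def)
qed

lemma standard_frame_operator:
  assumes f: "standard_frame ip J f"
  shows selfadjoint_frame_operator: "selfadjoint_op (frame_operator ip J f)"
    and surj_frame_operator: "surj (frame_operator ip J f)"
    and frame_operator_adj_transform:
      "frame_operator ip J f (frame_transform_adj ip J f (frame_transform ip J f u)) = u"
    and adj_transform_frame_operator:
      "frame_transform_adj ip J f (frame_transform ip J f (frame_operator ip J f u)) = u"
proof -
  obtain T where T: "selfadjoint_op T" "\<And>u. frame_operator ip J f u = T (T u)"
    and inv: "\<And>u. frame_operator ip J f (frame_transform_adj ip J f (frame_transform ip J f u)) = u"
    "\<And>u. frame_transform_adj ip J f (frame_transform ip J f (frame_operator ip J f u)) = u"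
    by (rule standard_frame_inverse_sqrt[OF f]) blast
  show "selfadjoint_op (frame_operator ip J f)"
    using T(1) by (simp add: selfadjoint_op_def T(2))
  show "surj (frame_operator ip J f)"
    using inv(1) by (rule surjI)
  show "frame_operator ip J f (frame_transform_adj ip J f (frame_transform ip J f u)) = u"
    "frame_transform_adj ip J f (frame_transform ip J f (frame_operator ip J f u)) = u"
    by (fact inv)+
qed

lemma standard_frame_canonical_dual:
  assumes f: "standard_frame ip J f"
  shows "standard_frame ip J (canonical_dual ip J f)"
proof -
  obtain T where T: "selfadjoint_op T" "\<And>u. frame_operator ip J f u = T (T u)"
    "\<And>u. (\<lambda>j. if j \<in> J then ip (T u) (f j) * ip (f j) (T u) else 0) sums ip u u"
    by (rule standard_frame_inverse_sqrt[OF f]) blast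
  obtain C D where C: "C > 0" and D: "D > 0" and bounds: "standard_frame_bounds ip J f C D"
    using f by (auto simp: standard_frame_def)
  have lower: "npos (ip u u - C *\<^sub>R ip (T u) (T u))" and upper: "npos (D *\<^sub>R ip (T u) (T u) - ip u u)"
    for u
    using bounds[unfolded standard_frame_bounds_def, rule_format, of "T u"]
    by (simp_all add: cstar_le_iff_npos sums_unique[OF T(3), symmetric])
  have sums: "(\<lambda>j. if j \<in> J then ip u (canonical_dual ip J f j) * ip (canonical_dual ip J f j) u else 0)
      sums ip (T u) (T u)" for u
  proof -
    have "ip u (T (T v)) = ip (T (T u)) v" "ip (T (T v)) u = ip v (T (T u))" for v
      by (simp_all add: selfadjoint_opD[OF T(1)])
    then show ?thesis
      using T(3)[of "T u"] by (simp add: canonical_dual_def T(2) cong: if_cong)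
  qed
  have "npos ((1 / D) *\<^sub>R (D *\<^sub>R ip (T u) (T u) - ip u u))"
    "npos ((1 / C) *\<^sub>R (ip u u - C *\<^sub>R ip (T u) (T u)))" for u
    using C D by (intro npos_scaleR lower upper; simp)+
  \<comment> \<open>At \<open>T u\<close> the frame series of \<open>f\<close> sums to
    \<open>\<langle>u,u\<rangle>\<close>, and the dual series at \<open>u\<close> sums to
    \<open>\<langle>T u, T u\<rangle>\<close>. The old inequalities at \<open>T u\<close> are
    therefore the new ones, with the bounds inverted and exchanged.\<close>
  then have "standard_frame_bounds ip J (canonical_dual ip J f) (1 / D) (1 / C)"
    unfolding standard_frame_bounds_def cstar_le_iff_npos sums_unique[OF sums, symmetric]
    using C D sums by (auto simp: scaleR_diff_right intro: sums_summable)
  then show ?thesis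
    unfolding standard_frame_def using C D by (intro exI[of _ "1 / D"] conjI exI[of _ "1 / C"]) auto
qed

text \<open>Taking adjoints in \<open>R T = 1\<close> shows that the adjoint of \<open>R\<close> is
  a right inverse of the adjoint of \<open>T\<close>.\<close>

lemma invertible_adjointable_adjoint_surj:
  assumes "invertible_adjointable smul ip T"
  obtains T' where "\<And>u z. ip (T' u) z = ip u (T z)" "surj T'"
proof -
  obtain R where R: "R \<circ> T = id" "bounded_adjointable smul ip R"
    and "bounded_adjointable smul ip T"
    using assms unfolding invertible_adjointable_def by blast
  then obtain T' R' where T': "\<And>x y. ip (T x) y = ip x (T' y)" and R': "\<And>x y. ip (R x) y = ip x (R' y)"
    unfolding bounded_adjointable_def is_adjoint_def by auto
  have 1: "ip (T' u) z = ip u (T z)" for u z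
    using arg_cong[OF T'[of z u], of star] by (simp add: ip_star)
  have "ip (T' (R' u)) z = ip u z" for u z
  proof -
    have "R (T z) = z"
      using R(1) by (metis comp_apply id_apply)
    then show ?thesis
      using 1[of "R' u" z] arg_cong[OF R'[of "T z" u], of star] by (simp add: ip_star)
  qed
  then have "T' (R' u) = u" for u
    by (rule ip_eqI)
  then show ?thesis
    using that 1 surjI by metis
qed

end

section \<open>Pairs of frames\<close>

locale hilbert_module_pair =
  H: hilbert_module smulH ipH + K: hilbert_module smulK ipK
  for smulH :: "'a::cstar_algebra \<Rightarrow> 'h::ab_group_add \<Rightarrow> 'h" and ipH :: "'h \<Rightarrow> 'h \<Rightarrow> 'a"
    and smulK :: "'a \<Rightarrow> 'k::ab_group_add \<Rightarrow> 'k" and ipK :: "'k \<Rightarrow> 'k \<Rightarrow> 'a"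
begin

lemma gram_zero_sym: "gram_zero ipH ipK J f g \<longleftrightarrow> gram_zero ipK ipH J g f"
proof -
  have "(\<lambda>j. star (if j \<in> J then ipH u (f j) * ipK (g j) w else 0))
      = (\<lambda>j. if j \<in> J then ipK w (g j) * ipH (f j) u else 0)"
    "(\<lambda>j. star (if j \<in> J then ipK w (g j) * ipH (f j) u else 0))
      = (\<lambda>j. if j \<in> J then ipH u (f j) * ipK (g j) w else 0)" for u w
    by (auto simp: star_mult H.ip_star K.ip_star)
  then have "(\<lambda>j. if j \<in> J then ipH u (f j) * ipK (g j) w else 0) sums 0
      \<longleftrightarrow> (\<lambda>j. if j \<in> J then ipK w (g j) * ipH (f j) u else 0) sums 0" for u w
    using star_sums[of "\<lambda>j. if j \<in> J then ipH u (f j) * ipK (g j) w else 0" 0]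
      star_sums[of "\<lambda>j. if j \<in> J then ipK w (g j) * ipH (f j) u else 0" 0] by auto
  then show ?thesis
    unfolding gram_zero_def by blast
qed

lemma gram_zero_left:
  assumes T: "\<And>u z. ipH (T' u) z = ipH u (T z)" "surj T'"
  shows "gram_zero ipH ipK J (\<lambda>j. T (f j)) g \<longleftrightarrow> gram_zero ipH ipK J f g"
proof -
  have "(\<forall>u. P (T' u)) \<longleftrightarrow> (\<forall>u. P u)" for P
    using T(2) by (metis surjD)
  then show ?thesis
    unfolding gram_zero_def T(1)[symmetric] .
qed

text \<open>Passing from the scalar series back to the module series takes two facts: the module
  series converges because its coefficients are square summable and \<open>g\<close> is Bessel, and
  its limit is orthogonal to every vector.\<close>

lemma mod_sums_zero_iff_gram_zero:
  assumes f: "standard_frame ipH J f" and g: "standard_frame ipK J g"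
  shows "(\<forall>u. mod_sums ipK J (\<lambda>j. smulK (ipH u (f j)) (g j)) 0) \<longleftrightarrow> gram_zero ipH ipK J f g"
proof
  assume L: "\<forall>u. mod_sums ipK J (\<lambda>j. smulK (ipH u (f j)) (g j)) 0"
  show "gram_zero ipH ipK J f g"
    unfolding gram_zero_def
  proof (intro allI)
    fix u w
    show "(\<lambda>j. if j \<in> J then ipH u (f j) * ipK (g j) w else 0) sums 0"
      using K.mod_sums_ip[OF L[rule_format, of u], of w] by simp
  qed
next
  assume R: "gram_zero ipH ipK J f g"
  obtain D where D: "K.bessel J g D"
    using K.standard_frame_bessel[OF g] by blast
  show "\<forall>u. mod_sums ipK J (\<lambda>j. smulK (ipH u (f j)) (g j)) 0"
  proof
    fix u
    have "summable (\<lambda>j. if j \<in> J then ipH u (f j) * star (ipH u (f j)) else 0)"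
      using f unfolding standard_frame_def standard_frame_bounds_def H.ip_star by blast
    from K.bessel_mod_sums[OF D this]
    obtain s where s: "mod_sums ipK J (\<lambda>j. smulK (ipH u (f j)) (g j)) s"
      by blast
    have "ipK s w = ipK 0 w" for w
      using sums_unique2[OF K.mod_sums_ip[OF s, of w]] R unfolding gram_zero_def by simp
    then have "s = 0"
      by (rule K.ip_eqI)
    with s show "mod_sums ipK J (\<lambda>j. smulK (ipH u (f j)) (g j)) 0"
      by simp
  qed
qed

abbreviation "smulD \<equiv> dsum_smul smulH smulK"
abbreviation "ipD \<equiv> dsum_ip ipH ipK"

text \<open>Makes convergence in the direct sum componentwise; the first two bounds come from order
  monotonicity of the norm.\<close>

lemma dsum_norm_bounds:
  "mod_norm ipH (fst u) \<le> mod_norm ipD u" "mod_norm ipK (snd u) \<le> mod_norm ipD u"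
  "mod_norm ipD u \<le> mod_norm ipH (fst u) + mod_norm ipK (snd u)"
proof -
  have "norm (ipH (fst u) (fst u)) \<le> norm (ipD u u)" "norm (ipK (snd u) (snd u)) \<le> norm (ipD u u)"
    by (intro npos_norm_mono; simp add: dsum_ip_def H.npos_ip K.npos_ip)+
  then show "mod_norm ipH (fst u) \<le> mod_norm ipD u" "mod_norm ipK (snd u) \<le> mod_norm ipD u"
    by (simp_all add: mod_norm_def)
  have "norm (ipD u u) \<le> norm (ipH (fst u) (fst u)) + norm (ipK (snd u) (snd u))"
    by (simp add: dsum_ip_def norm_triangle_ineq)
  then show "mod_norm ipD u \<le> mod_norm ipH (fst u) + mod_norm ipK (snd u)"
    unfolding mod_norm_def
    by (meson order_trans real_sqrt_le_iff sqrt_add_le_add_sqrt norm_ge_zero)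
qed

sublocale D: hilbert_module smulD ipD
proof
  fix a b :: 'a and u v w :: "'h \<times> 'k" and X :: "nat \<Rightarrow> 'h \<times> 'k"
  show "smulD a (u + v) = smulD a u + smulD a v"
    by (simp add: dsum_smul_def H.smul_add_right K.smul_add_right)
  show "smulD (a + b) u = smulD a u + smulD b u"
    by (simp add: dsum_smul_def H.smul_add_left K.smul_add_left)
  show "smulD a (smulD b u) = smulD (a * b) u"
    by (simp add: dsum_smul_def H.smul_smul K.smul_smul)
  show "smulD 1 u = u"
    by (simp add: dsum_smul_def H.smul_one K.smul_one)
  show "ipD (u + v) w = ipD u w + ipD v w"
    by (simp add: dsum_ip_def H.ip_add_left K.ip_add_left)
  show "ipD (smulD a u) v = a * ipD u v"
    by (simp add: dsum_ip_def dsum_smul_def H.ip_smul_left K.ip_smul_left distrib_left)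
  show "star (ipD u v) = ipD v u"
    by (simp add: dsum_ip_def star_add H.ip_star K.ip_star)
  show "cstar_positive (ipD u u)"
    by (simp add: dsum_ip_def cstar_positive_iff_npos npos_add H.npos_ip K.npos_ip)
  show "u = 0" if "ipD u u = 0"
  proof -
    have "mod_norm ipD u = 0"
      using that by (simp add: mod_norm_def)
    then have "fst u = 0" "snd u = 0"
      using dsum_norm_bounds(1,2)[of u] H.mnorm_ge_0[of "fst u"] K.mnorm_ge_0[of "snd u"] by force+
    then show ?thesis
      by (simp add: prod_eq_iff)
  qed
  assume C: "\<And>e. e > 0 \<Longrightarrow> \<exists>N. \<forall>m\<ge>N. \<forall>n\<ge>N. mod_norm ipD (X m - X n) < e"
  have "\<exists>l. (\<lambda>n. mod_norm ipH (fst (X n) - l)) \<longlonglongrightarrow> 0"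
  proof (rule H.mod_complete)
    fix e :: real assume "e > 0"
    then show "\<exists>N. \<forall>m\<ge>N. \<forall>n\<ge>N. mod_norm ipH (fst (X m) - fst (X n)) < e"
      using C dsum_norm_bounds(1) unfolding fst_diff[symmetric] by (meson order_le_less_trans)
  qed
  then obtain h where h: "(\<lambda>n. mod_norm ipH (fst (X n) - h)) \<longlonglongrightarrow> 0"
    by blast
  have "\<exists>l. (\<lambda>n. mod_norm ipK (snd (X n) - l)) \<longlonglongrightarrow> 0"
  proof (rule K.mod_complete)
    fix e :: real assume "e > 0"
    then show "\<exists>N. \<forall>m\<ge>N. \<forall>n\<ge>N. mod_norm ipK (snd (X m) - snd (X n)) < e"
      using C dsum_norm_bounds(2) unfolding snd_diff[symmetric] by (meson order_le_less_trans)
  qed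
  then obtain k where k: "(\<lambda>n. mod_norm ipK (snd (X n) - k)) \<longlonglongrightarrow> 0"
    by blast
  have "(\<lambda>n. mod_norm ipD (X n - (h, k))) \<longlonglongrightarrow> 0"
  proof (rule Lim_null_comparison)
    show "(\<lambda>n. mod_norm ipH (fst (X n) - h) + mod_norm ipK (snd (X n) - k)) \<longlonglongrightarrow> 0"
      using tendsto_add[OF h k] by simp
    show "\<forall>\<^sub>F n in sequentially. norm (mod_norm ipD (X n - (h, k)))
        \<le> mod_norm ipH (fst (X n) - h) + mod_norm ipK (snd (X n) - k)"
      using dsum_norm_bounds(3)[of "X n - (h, k)" for n] by (simp add: mod_norm_def)
  qed
  then show "\<exists>l. (\<lambda>n. mod_norm ipD (X n - l)) \<longlonglongrightarrow> 0"
    by blast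
qed

lemma inner_sum_sums_of_gram_zero:
  assumes 0: "gram_zero ipH ipK J f g"
    and s: "(\<lambda>j. if j \<in> J then ipH u (f j) * ipH (f j) u' else 0) sums s"
    and t: "(\<lambda>j. if j \<in> J then ipK w (g j) * ipK (g j) w' else 0) sums t"
  shows "(\<lambda>j. if j \<in> J then ipD (u, w) (inner_sum f g j) * ipD (inner_sum f g j) (u', w') else 0)
    sums (s + t)"
proof -
  have cross: "(\<lambda>j. if j \<in> J then ipH u (f j) * ipK (g j) w' else 0) sums 0"
    "(\<lambda>j. if j \<in> J then ipK w (g j) * ipH (f j) u' else 0) sums 0"
    using 0 gram_zero_sym[of J f g] unfolding gram_zero_def by blast+
  have "(\<lambda>j. if j \<in> J then ipD (u, w) (inner_sum f g j) * ipD (inner_sum f g j) (u', w') else 0)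
    = (\<lambda>j. (if j \<in> J then ipH u (f j) * ipH (f j) u' else 0)
        + (if j \<in> J then ipK w (g j) * ipK (g j) w' else 0)
        + ((if j \<in> J then ipH u (f j) * ipK (g j) w' else 0)
          + (if j \<in> J then ipK w (g j) * ipH (f j) u' else 0)))"
    by (auto simp: dsum_ip_def inner_sum_def algebra_simps fun_eq_iff)
  then show ?thesis
    using sums_add[OF sums_add[OF s t] sums_add[OF cross]] by simp
qed

lemma gram_zero_of_inner_sum_tight:
  assumes f: "standard_tight_frame ipH J f" and g: "standard_tight_frame ipK J g"
    and fg: "standard_tight_frame ipD J (inner_sum f g)"
  shows "gram_zero ipH ipK J f g"
  unfolding gram_zero_def
proof (intro allI)
  fix u w
  let ?ad = "\<lambda>w j. ipH u (f j) * ipK (g j) w" and ?bc = "\<lambda>w j. ipK w (g j) * ipH (f j) u"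
  have cross: "(\<lambda>j. if j \<in> J then ?ad w j + ?bc w j else 0) sums 0" for w
  proof -
    have "(\<lambda>j. if j \<in> J then ipD (u, w) (inner_sum f g j) * ipD (inner_sum f g j) (u, w) else 0)
        sums ipD (u, w) (u, w)"
      "(\<lambda>j. if j \<in> J then ipH u (f j) * ipH (f j) u else 0) sums ipH u u"
      "(\<lambda>j. if j \<in> J then ipK w (g j) * ipK (g j) w else 0) sums ipK w w"
      using f g fg unfolding sums_tight_iff by blast+
    from sums_diff[OF sums_diff[OF this(1,2)] this(3)]
    have "(\<lambda>j. (if j \<in> J then ipD (u, w) (inner_sum f g j) * ipD (inner_sum f g j) (u, w) else 0)
        - (if j \<in> J then ipH u (f j) * ipH (f j) u else 0)
        - (if j \<in> J then ipK w (g j) * ipK (g j) w else 0)) sums 0"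
      by (simp add: dsum_ip_def)
    also have "(\<lambda>j. (if j \<in> J then ipD (u, w) (inner_sum f g j) * ipD (inner_sum f g j) (u, w) else 0)
        - (if j \<in> J then ipH u (f j) * ipH (f j) u else 0)
        - (if j \<in> J then ipK w (g j) * ipK (g j) w else 0))
      = (\<lambda>j. if j \<in> J then ?ad w j + ?bc w j else 0)"
      by (auto simp: dsum_ip_def inner_sum_def algebra_simps fun_eq_iff)
    finally show ?thesis .
  qed
  \<comment> \<open>Replacing \<open>w\<close> by \<open>i w\<close> multiplies the conjugate-linear
    term by \<open>- i\<close> and the linear one by \<open>i\<close>. A further factor
    \<open>i\<close> leaves their difference.\<close>
  have "scaleC \<i> 1 * (if j \<in> J then ?ad (smulK (scaleC \<i> 1) w) j + ?bc (smulK (scaleC \<i> 1) w) j else 0)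
      = (if j \<in> J then ?ad w j - ?bc w j else 0)" for j
    by (simp add: K.ip_smul_left K.ip_smul_right star_scaleC mult_scaleC_left mult_scaleC_right
        scaleC_scaleC scaleC_add_right algebra_simps)
  with sums_mult[OF cross[of "smulK (scaleC \<i> 1) w"], of "scaleC \<i> 1"]
  have "(\<lambda>j. if j \<in> J then ?ad w j - ?bc w j else 0) sums 0"
    by simp
  from sums_add[OF cross[of w] this]
  have "(\<lambda>j. (if j \<in> J then ?ad w j + ?bc w j else 0) + (if j \<in> J then ?ad w j - ?bc w j else 0))
      sums 0"
    by simp
  also have "(\<lambda>j. (if j \<in> J then ?ad w j + ?bc w j else 0) + (if j \<in> J then ?ad w j - ?bc w j else 0))
      = (\<lambda>j. 2 *\<^sub>R (if j \<in> J then ?ad w j else 0))"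
    by (auto simp: fun_eq_iff scaleR_2)
  finally have "(\<lambda>j. 2 *\<^sub>R (if j \<in> J then ?ad w j else 0)) sums 0" .
  from sums_scaleR_right[OF this, of "1/2"]
  show "(\<lambda>j. if j \<in> J then ?ad w j else 0) sums 0"
    by simp
qed

lemma strongly_disjoint_iff_gram_zero:
  assumes f: "standard_frame ipH J f" and g: "standard_frame ipK J g"
  shows "strongly_disjoint smulH ipH smulK ipK J f g \<longleftrightarrow> gram_zero ipH ipK J f g"
proof -
  \<comment> \<open>With the modules exchanged, the facts about the first frame become available for
    the second.\<close>
  interpret KH: hilbert_module_pair smulK ipK smulH ipH ..
  have move: "gram_zero ipH ipK J (\<lambda>j. T\<^sub>1 (f j)) (\<lambda>j. T\<^sub>2 (g j)) \<longleftrightarrow> gram_zero ipH ipK J f g"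
    if "invertible_adjointable smulH ipH T\<^sub>1" "invertible_adjointable smulK ipK T\<^sub>2" for T\<^sub>1 T\<^sub>2
  proof -
    note inv = that
    obtain T1 where T1: "\<And>u z. ipH (T1 u) z = ipH u (T\<^sub>1 z)" "surj T1"
      by (rule H.invertible_adjointable_adjoint_surj[OF inv(1)]) (rule that)
    obtain T2 where T2: "\<And>u z. ipK (T2 u) z = ipK u (T\<^sub>2 z)" "surj T2"
      by (rule K.invertible_adjointable_adjoint_surj[OF inv(2)]) (rule that)
    have "gram_zero ipH ipK J (\<lambda>j. T\<^sub>1 (f j)) (\<lambda>j. T\<^sub>2 (g j))
        \<longleftrightarrow> gram_zero ipK ipH J (\<lambda>j. T\<^sub>2 (g j)) f"
      using gram_zero_left[OF T1] gram_zero_sym by simp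
    also have "\<dots> \<longleftrightarrow> gram_zero ipH ipK J f g"
      using KH.gram_zero_left[OF T2] gram_zero_sym by simp
    finally show ?thesis .
  qed
  show ?thesis
  proof
    assume "strongly_disjoint smulH ipH smulK ipK J f g"
    then obtain T\<^sub>1 T\<^sub>2 where T: "invertible_adjointable smulH ipH T\<^sub>1" "invertible_adjointable smulK ipK T\<^sub>2"
      "strongly_disjoint_tight ipH ipK J (\<lambda>j. T\<^sub>1 (f j)) (\<lambda>j. T\<^sub>2 (g j))"
      unfolding strongly_disjoint_def by blast
    then have "gram_zero ipH ipK J (\<lambda>j. T\<^sub>1 (f j)) (\<lambda>j. T\<^sub>2 (g j))"
      unfolding strongly_disjoint_tight_def using gram_zero_of_inner_sum_tight by blast
    then show "gram_zero ipH ipK J f g"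
      using move[OF T(1,2)] by simp
  next
    assume 0: "gram_zero ipH ipK J f g"
    obtain T\<^sub>1 where T1: "invertible_adjointable smulH ipH T\<^sub>1" "H.selfadjoint_op T\<^sub>1"
      "\<And>u. (\<lambda>j. if j \<in> J then ipH (T\<^sub>1 u) (f j) * ipH (f j) (T\<^sub>1 u) else 0) sums ipH u u"
      by (rule H.standard_frame_inverse_sqrt[OF f]) blast
    obtain T\<^sub>2 where T2: "invertible_adjointable smulK ipK T\<^sub>2" "K.selfadjoint_op T\<^sub>2"
      "\<And>u. (\<lambda>j. if j \<in> J then ipK (T\<^sub>2 u) (g j) * ipK (g j) (T\<^sub>2 u) else 0) sums ipK u u"
      by (rule K.standard_frame_inverse_sqrt[OF g]) blast
    have t1: "standard_tight_frame ipH J (\<lambda>j. T\<^sub>1 (f j))"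
      using T1(3) by (simp add: sums_tight_iff H.selfadjoint_opD[OF T1(2)] cong: if_cong)
    have t2: "standard_tight_frame ipK J (\<lambda>j. T\<^sub>2 (g j))"
      using T2(3) by (simp add: sums_tight_iff K.selfadjoint_opD[OF T2(2)] cong: if_cong)
    have "standard_tight_frame ipD J (inner_sum (\<lambda>j. T\<^sub>1 (f j)) (\<lambda>j. T\<^sub>2 (g j)))"
      unfolding sums_tight_iff
    proof
      fix v :: "'h \<times> 'k"
      obtain u w where v: "v = (u, w)"
        by fastforce
      have "gram_zero ipH ipK J (\<lambda>j. T\<^sub>1 (f j)) (\<lambda>j. T\<^sub>2 (g j))"
        using 0 move T1(1) T2(1) by blast
      from inner_sum_sums_of_gram_zero[OF this t1[unfolded sums_tight_iff, rule_format, of u]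
          t2[unfolded sums_tight_iff, rule_format, of w]]
      show "(\<lambda>j. if j \<in> J then ipD v (inner_sum (\<lambda>j. T\<^sub>1 (f j)) (\<lambda>j. T\<^sub>2 (g j)) j)
          * ipD (inner_sum (\<lambda>j. T\<^sub>1 (f j)) (\<lambda>j. T\<^sub>2 (g j)) j) v else 0) sums ipD v v"
        by (simp add: v dsum_ip_def[of _ _ "(u, w)" "(u, w)"] cong: if_cong)
    qed
    then show "strongly_disjoint smulH ipH smulK ipK J f g"
      unfolding strongly_disjoint_def strongly_disjoint_tight_def
      using f g T1(1) T2(1) t1 t2 by blast
  qed
qed

lemma inner_sum_frame_iff_gram_zero:
  assumes f: "standard_frame ipH J f" and g: "standard_frame ipK J g"
  shows "standard_frame ipD J (inner_sum f g) \<and>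
      frame_operator ipD J (inner_sum f g) = map_prod (frame_operator ipH J f) (frame_operator ipK J g)
    \<longleftrightarrow> gram_zero ipH ipK J f g"
proof (intro iffI conjI)
  let ?S = "frame_operator ipH J f" and ?S' = "frame_operator ipK J g"
  let ?G = "\<lambda>u. frame_transform_adj ipH J f (frame_transform ipH J f u)"
  let ?G' = "\<lambda>u. frame_transform_adj ipK J g (frame_transform ipK J g u)"
  let ?GD = "\<lambda>u. frame_transform_adj ipD J (inner_sum f g) (frame_transform ipD J (inner_sum f g) u)"
  {
    assume L: "standard_frame ipD J (inner_sum f g) \<and>
        frame_operator ipD J (inner_sum f g) = map_prod ?S ?S'"
    show "gram_zero ipH ipK J f g"
      unfolding gram_zero_def
    proof (intro allI)
      fix u w
      \<comment> \<open>Invertibility of the second block kills the second component of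
        \<open>?GD (u, 0)\<close>, and its inner product with \<open>w\<close> is the cross series
        at \<open>u\<close> and \<open>w\<close>.\<close>
      have "map_prod ?S ?S' (?GD (u, 0)) = (u, 0)"
        using L D.frame_operator_adj_transform by metis
      then have "?S' (snd (?GD (u, 0))) = 0"
        by (metis snd_conv snd_map_prod)
      moreover have "inj ?S'"
        using K.adj_transform_frame_operator[OF g] by (rule inj_on_inverseI)
      moreover have "?S' 0 = 0"
        using K.selfadjoint_op_diff[OF K.selfadjoint_frame_operator[OF g], of 0 0] by simp
      ultimately have "snd (?GD (u, 0)) = 0"
        by (metis injD)
      then show "(\<lambda>j. if j \<in> J then ipH u (f j) * ipK (g j) w else 0) sums 0"
        using D.adj_transform_sums[of J "inner_sum f g" "(u, 0)" "(0, w)"] L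
        by (simp add: dsum_ip_def inner_sum_def cong: if_cong)
    qed
  }
  {
    assume 0: "gram_zero ipH ipK J f g"
    have sums: "(\<lambda>j. if j \<in> J then ipD v (inner_sum f g j) * ipD (inner_sum f g j) v' else 0)
        sums (ipH (?G (fst v)) (fst v') + ipK (?G' (snd v)) (snd v'))" for v v'
      using inner_sum_sums_of_gram_zero[OF 0 H.adj_transform_sums[OF f] K.adj_transform_sums[OF g],
          where u = "fst v" and u' = "fst v'" and w = "snd v" and w' = "snd v'"]
      unfolding prod.collapse .
    obtain C D where C: "C > 0" "D > 0" and Cf: "standard_frame_bounds ipH J f C D"
      using f by (auto simp: standard_frame_def)
    obtain C' D' where C': "C' > 0" "D' > 0" and Cg: "standard_frame_bounds ipK J g C' D'"
      using g by (auto simp: standard_frame_def)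
    have bf: "npos (ipH (?G u) u - C *\<^sub>R ipH u u)" "npos (D *\<^sub>R ipH u u - ipH (?G u) u)" for u
      using Cf by (auto simp: standard_frame_bounds_def cstar_le_iff_npos
          sums_unique[OF H.adj_transform_sums[OF f], symmetric])
    have bg: "npos (ipK (?G' w) w - C' *\<^sub>R ipK w w)" "npos (D' *\<^sub>R ipK w w - ipK (?G' w) w)" for w
      using Cg by (auto simp: standard_frame_bounds_def cstar_le_iff_npos
          sums_unique[OF K.adj_transform_sums[OF g], symmetric])
    have "standard_frame_bounds ipD J (inner_sum f g) (min C C') (max D D')"
      unfolding standard_frame_bounds_def cstar_le_iff_npos sums_unique[OF sums, symmetric]
    proof (intro allI conjI)
      fix v :: "'h \<times> 'k"
      show "summable (\<lambda>j. if j \<in> J then ipD v (inner_sum f g j) * ipD (inner_sum f g j) v else 0)"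
        using sums by (rule sums_summable)
      \<comment> \<open>Each component has its own bound; the surplus over the common bound is a
        nonnegative multiple of that component's inner square.\<close>
      have "npos ((ipH (?G (fst v)) (fst v) - C *\<^sub>R ipH (fst v) (fst v))
          + (C - min C C') *\<^sub>R ipH (fst v) (fst v)
          + (ipK (?G' (snd v)) (snd v) - C' *\<^sub>R ipK (snd v) (snd v))
          + (C' - min C C') *\<^sub>R ipK (snd v) (snd v))"
        by (intro npos_add bf bg npos_scaleR H.npos_ip K.npos_ip) auto
      then show "npos (ipH (?G (fst v)) (fst v) + ipK (?G' (snd v)) (snd v) - min C C' *\<^sub>R ipD v v)"
        by (simp add: dsum_ip_def algebra_simps)
      have "npos ((D *\<^sub>R ipH (fst v) (fst v) - ipH (?G (fst v)) (fst v))
          + (max D D' - D) *\<^sub>R ipH (fst v) (fst v)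
          + (D' *\<^sub>R ipK (snd v) (snd v) - ipK (?G' (snd v)) (snd v))
          + (max D D' - D') *\<^sub>R ipK (snd v) (snd v))"
        by (intro npos_add bf bg npos_scaleR H.npos_ip K.npos_ip) auto
      then show "npos (max D D' *\<^sub>R ipD v v - (ipH (?G (fst v)) (fst v) + ipK (?G' (snd v)) (snd v)))"
        by (simp add: dsum_ip_def algebra_simps)
    qed
    then show fr: "standard_frame ipD J (inner_sum f g)"
      unfolding standard_frame_def using C C' by (intro exI[of _ "min C C'"] conjI exI[of _ "max D D'"]) auto
    have GD: "?GD v = map_prod ?G ?G' v" for v
    proof (rule D.ip_eqI)
      fix v'
      show "ipD (?GD v) v' = ipD (map_prod ?G ?G' v) v'"
        using sums_unique2[OF D.adj_transform_sums[OF fr] sums, of v v'] by (simp add: dsum_ip_def)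
    qed
    show "frame_operator ipD J (inner_sum f g) = map_prod ?S ?S'"
      unfolding frame_operator_def[of ipD]
      by (rule inv_equality)
        (auto simp: GD H.frame_operator_adj_transform[OF f] H.adj_transform_frame_operator[OF f]
          K.frame_operator_adj_transform[OF g] K.adj_transform_frame_operator[OF g])
  }
qed

end

theorem proposition6p5:
  fixes smulH :: "'a::cstar_algebra \<Rightarrow> 'h::ab_group_add \<Rightarrow> 'h" and ipH :: "'h \<Rightarrow> 'h \<Rightarrow> 'a"
    and smulK :: "'a \<Rightarrow> 'k::ab_group_add \<Rightarrow> 'k" and ipK :: "'k \<Rightarrow> 'k \<Rightarrow> 'a"
    and J :: "nat set" and x :: "nat \<Rightarrow> 'h" and y :: "nat \<Rightarrow> 'k"
  assumes "hilbert_module smulH ipH" and "hilbert_module smulK ipK"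
    and "finitely_generated smulH \<or> countably_generated smulH ipH"
    and "finitely_generated smulK \<or> countably_generated smulK ipK"
    and "\<exists>I b. standard_riesz_basis (dsum_smul smulH smulK) (dsum_ip ipH ipK) I b"
    and "standard_frame ipH J x" and "standard_frame ipK J y"
  shows
    "let Sx = frame_operator ipH J x;
         Sy = frame_operator ipK J y;
         i = strongly_disjoint smulH ipH smulK ipK J x y;
         ii = strongly_disjoint smulH ipH smulK ipK J (canonical_dual ipH J x) (canonical_dual ipK J y);
         iii = (standard_frame (dsum_ip ipH ipK) J (inner_sum x y) \<and>
                frame_operator (dsum_ip ipH ipK) J (inner_sum x y) = map_prod Sx Sy);
         iv = (\<forall>u. mod_sums ipK J (\<lambda>j. smulK (ipH u (Sx (x j))) (y j)) 0);
         v = (\<forall>w. mod_sums ipH J (\<lambda>j. smulH (ipK w (Sy (y j))) (x j)) 0);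
         vi = (\<forall>u. mod_sums ipK J (\<lambda>j. smulK (ipH u (x j)) (Sy (y j))) 0);
         vii = (\<forall>w. mod_sums ipH J (\<lambda>j. smulH (ipK w (y j)) (Sx (x j))) 0);
         viii = (\<forall>u. mod_sums ipK J (\<lambda>j. smulK (ipH u (x j)) (y j)) 0);
         ix = (\<forall>w. mod_sums ipH J (\<lambda>j. smulH (ipK w (y j)) (x j)) 0)
     in (i \<longleftrightarrow> ii) \<and> (i \<longleftrightarrow> iii) \<and> (i \<longleftrightarrow> iv) \<and> (i \<longleftrightarrow> v) \<and> (i \<longleftrightarrow> vi) \<and>
        (i \<longleftrightarrow> vii) \<and> (i \<longleftrightarrow> viii) \<and> (i \<longleftrightarrow> ix)"
proof -
  interpret hilbert_module_pair smulH ipH smulK ipK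
    using assms(1,2) by (simp add: hilbert_module_pair_def)
  interpret KH: hilbert_module_pair smulK ipK smulH ipH ..
  note fx = assms(6) and fy = assms(7)
  define Sx Sy where "Sx = frame_operator ipH J x" and "Sy = frame_operator ipK J y"
  \<comment> \<open>The canonical duals are again standard frames, so the equivalences for arbitrary
    pairs also apply to the pairs in (ii) and (iv) to (vii).\<close>
  have dx: "standard_frame ipH J (\<lambda>j. Sx (x j))" and dy: "standard_frame ipK J (\<lambda>j. Sy (y j))"
    using H.standard_frame_canonical_dual[OF fx] K.standard_frame_canonical_dual[OF fy]
    by (simp_all add: canonical_dual_def[abs_def] Sx_def Sy_def)
  have Sx: "\<And>u z. ipH (Sx u) z = ipH u (Sx z)" "surj Sx"
    unfolding Sx_def
    using H.selfadjoint_frame_operator[OF fx] H.surj_frame_operator[OF fx]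
    by (simp_all add: H.selfadjoint_op_def)
  have Sy: "\<And>u z. ipK (Sy u) z = ipK u (Sy z)" "surj Sy"
    unfolding Sy_def
    using K.selfadjoint_frame_operator[OF fy] K.surj_frame_operator[OF fy]
    by (simp_all add: K.selfadjoint_op_def)
  have "gram_zero ipH ipK J x (\<lambda>j. Sy (y j)) \<longleftrightarrow> gram_zero ipH ipK J x y"
    using gram_zero_sym KH.gram_zero_left[OF Sy] by blast
  moreover have "gram_zero ipK ipH J y (\<lambda>j. Sx (x j)) \<longleftrightarrow> gram_zero ipH ipK J x y"
    using KH.gram_zero_sym gram_zero_left[OF Sx] by blast
  ultimately show ?thesis
    unfolding Let_def canonical_dual_def[abs_def] Sx_def[symmetric] Sy_def[symmetric]
      strongly_disjoint_iff_gram_zero[OF fx fy] strongly_disjoint_iff_gram_zero[OF dx dy]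
      mod_sums_zero_iff_gram_zero[OF fx fy] mod_sums_zero_iff_gram_zero[OF dx fy]
      mod_sums_zero_iff_gram_zero[OF fx dy]
      KH.mod_sums_zero_iff_gram_zero[OF fy fx] KH.mod_sums_zero_iff_gram_zero[OF dy fx]
      KH.mod_sums_zero_iff_gram_zero[OF fy dx]
    using inner_sum_frame_iff_gram_zero[OF fx fy, folded Sx_def Sy_def]
      gram_zero_left[OF Sx] KH.gram_zero_left[OF Sy] KH.gram_zero_sym[of J y x]
    by simp
qed

end
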